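(* Let $X$ be a normal toric affine variety over $\mathbf{k}$ with no torus factor, let $L$ be the Lie algebra generated by a finite set of root derivations $\partial_1,\ldots,\partial_s$ of $\mathcal{O}(X)$, and let $\Gamma_r=\Gamma_r(L)$ be the associated directed graph. Assume that $L$ contains no $2$-cycle of root derivations. Then $\Gamma_r$ is acyclic, that is, does not contain any oriented cycle, and the Lie algebra $L$ is finite-dimensional and nilpotent.
   Context: $\mathbf{k}$ is an algebraically closed field of characteristic zero. Let $N$ be a lattice of finite rank, $N^\vee$ the dual lattice, $\langle\cdot,\cdot\rangle:N\times N^\vee\to\mathbb{Z}$ the pairing. $X=\mathrm{Spec}\,\bigoplus_{m\in\Delta^\vee}\mathbf{k}\chi^m$, where $\Delta^\vee$ is the set of lattice points of the cone dual to a pointed rational polyhedral cone $\Delta_{\mathbb{Q}}\subset N_{\mathbb{Q}}$; "no torus factor" means that $\Delta_{\mathbb{Q}}$ is full-dimensional. Let $\rho_1,\ldots,\rho_k\in N$ be the ray generators (primitive lattice vectors on the extremal rays of $\Delta_{\mathbb{Q}}$). For $j=1,\dots,k$ put $S_j=\{e\in N^\vee\mid\langle\rho_j,e\rangle=-1,\ \langle\rho_i,e\rangle\ge0\ \forall i\ne j\}$; elements of $\bigcup_jS_j$ are the Demazure roots. To $e\in S_j$ is associated the root derivation $\partial_{\rho_j,e}$ of $\mathcal{O}(X)$, $\partial_{\rho_j,e}(\chi^m)=\langle\rho_j,m\rangle\chi^{m+e}$. Let $R_i=\{e\in S_i\mid\partial_{\rho_i,e}\in L\}$ and let $L_i\subset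 L$ be the abelian Lie subalgebra generated by $\partial_{\rho_i,e}$, $e\in R_i$. The ray generators are numbered so that $R_i\neq\emptyset$ iff $i\le r$. A $2$-cycle of root derivations in $L$ is a pair $\partial_{\rho_i,e},\partial_{\rho_j,e'}$ with $e\in R_i$, $e'\in R_j$, $\langle\rho_j,e\rangle>0$ and $\langle\rho_i,e'\rangle>0$. The directed graph $\Gamma_r(L)$ has the $r$ vertices $L_1,\ldots,L_r$, with a directed edge $[L_j\to L_i]$ if and only if $\langle\rho_j,e\rangle>0$ for some $e\in R_i$. *)

theory Defs
  imports
    "HOL-Library.Function_Algebras"
    "HOL-Library.Poly_Mapping"
    "HOL-Computational_Algebra.Polynomial"
    "Graph_Theory.Pair_Digraph"
begin

text \<open>
  The rational vector space \<open>N\<^sub>\<rat>\<close> is an arbitrary type \<open>'v\<close> with scalar multiplication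
  \<open>scale :: rat \<Rightarrow> 'v \<Rightarrow> 'v\<close>; the lattice \<open>N\<close> is a subset of it. The dual lattice consists of the
  \<open>\<rat>\<close>-linear forms that are integral on \<open>N\<close>, so that the pairing of \<open>v\<close> and \<open>m\<close> is \<open>m v\<close>. Linear forms
  are added pointwise. Rank 0 is allowed.
\<close>

definition full_lattice :: "(rat \<Rightarrow> 'v::ab_group_add \<Rightarrow> 'v) \<Rightarrow> 'v set \<Rightarrow> bool" where
  "full_lattice scale N \<longleftrightarrow>
     (\<exists>B. finite_dimensional_vector_space scale B \<and>
          N = {v. \<exists>z :: 'v \<Rightarrow> int. v = (\<Sum>b\<in>B. scale (of_int (z b)) b)})"

definition dual_lattice :: "(rat \<Rightarrow> 'v::ab_group_add \<Rightarrow> 'v) \<Rightarrow> 'v set \<Rightarrow> ('v \<Rightarrow> rat) set" where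
  "dual_lattice scale N = {m. Vector_Spaces.linear scale (*) m \<and> (\<forall>v\<in>N. m v \<in> \<int>)}"

definition polyhedral_cone :: "(rat \<Rightarrow> 'v::ab_group_add \<Rightarrow> 'v) \<Rightarrow> 'v set \<Rightarrow> bool" where
  "polyhedral_cone scale \<Delta> \<longleftrightarrow>
     (\<exists>G. finite G \<and> \<Delta> = {v. \<exists>c. (\<forall>g\<in>G. 0 \<le> c g) \<and> v = (\<Sum>g\<in>G. scale (c g) g)})"

definition pointed_cone :: "'v::ab_group_add set \<Rightarrow> bool" where
  "pointed_cone \<Delta> \<longleftrightarrow> (\<forall>v. v \<in> \<Delta> \<and> - v \<in> \<Delta> \<longrightarrow> v = 0)"

definition full_dimensional :: "(rat \<Rightarrow> 'v::ab_group_add \<Rightarrow> 'v) \<Rightarrow> 'v set \<Rightarrow> bool" where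
  "full_dimensional scale \<Delta> \<longleftrightarrow> module.span scale \<Delta> = UNIV"

definition ray :: "(rat \<Rightarrow> 'v::ab_group_add \<Rightarrow> 'v) \<Rightarrow> 'v \<Rightarrow> 'v set" where
  "ray scale v = {scale c v | c. 0 \<le> c}"

definition extremal_ray :: "(rat \<Rightarrow> 'v::ab_group_add \<Rightarrow> 'v) \<Rightarrow> 'v set \<Rightarrow> 'v set \<Rightarrow> bool" where
  "extremal_ray scale \<Delta> R \<longleftrightarrow>
     (\<exists>v. v \<noteq> 0 \<and> R = ray scale v) \<and> R \<subseteq> \<Delta> \<and>
     (\<forall>x\<in>\<Delta>. \<forall>y\<in>\<Delta>. x + y \<in> R \<longrightarrow> x \<in> R \<and> y \<in> R)"

definition primitive_vector :: "(rat \<Rightarrow> 'v::ab_group_add \<Rightarrow> 'v) \<Rightarrow> 'v set \<Rightarrow> 'v \<Rightarrow> bool" where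
  "primitive_vector scale N v \<longleftrightarrow>
     v \<in> N \<and> v \<noteq> 0 \<and> (\<forall>u\<in>N. \<forall>n::nat. v = scale (of_nat n) u \<longrightarrow> n = 1)"

definition ray_generators :: "(rat \<Rightarrow> 'v::ab_group_add \<Rightarrow> 'v) \<Rightarrow> 'v set \<Rightarrow> 'v set \<Rightarrow> 'v set" where
  "ray_generators scale N \<Delta> =
     {v. primitive_vector scale N v \<and> extremal_ray scale \<Delta> (ray scale v)}"

text \<open>The monoid \<open>\<Delta>\<^sup>\<or>\<close> of lattice points of the dual cone.\<close>

definition dual_monoid ::
    "(rat \<Rightarrow> 'v::ab_group_add \<Rightarrow> 'v) \<Rightarrow> 'v set \<Rightarrow> 'v set \<Rightarrow> ('v \<Rightarrow> rat) set" where
  "dual_monoid scale N \<Delta> = {m \<in> dual_lattice scale N. \<forall>v\<in>\<Delta>. 0 \<le> m v}"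

text \<open>
  The variety enters through its coordinate ring \<open>\<O>(X)\<close>. The character \<open>\<chi>\<^sup>m\<close> is \<open>single m 1\<close>, and the
  monoid algebra of \<open>S = \<Delta>\<^sup>\<or>\<close> is the subalgebra of elements supported in \<open>S\<close> of the ambient algebra
  of finitely supported functions under convolution.
\<close>

type_synonym ('v, 'k) char_alg = "('v \<Rightarrow> rat) \<Rightarrow>\<^sub>0 'k"

definition coord_ring :: "('v \<Rightarrow> rat) set \<Rightarrow> ('v, 'k::comm_ring_1) char_alg set" where
  "coord_ring S = {f. Poly_Mapping.keys f \<subseteq> S}"

definition scalar_mult :: "'k::comm_ring_1 \<Rightarrow> ('v, 'k) char_alg \<Rightarrow> ('v, 'k) char_alg" where
  "scalar_mult c f = Poly_Mapping.single 0 c * f"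

text \<open>
  A self-map of \<open>\<O>(X)\<close> is encoded as a function on the ambient algebra that vanishes outside of \<open>\<O>(X)\<close>,
  which makes the encoding unique and is preserved by linear combinations and commutators.
\<close>

type_synonym ('v, 'k) alg_op = "('v, 'k) char_alg \<Rightarrow> ('v, 'k) char_alg"

definition op_scale :: "'k::field \<Rightarrow> ('v, 'k) alg_op \<Rightarrow> ('v, 'k) alg_op" where
  "op_scale c D = (\<lambda>f. scalar_mult c (D f))"

definition lie_bracket :: "('v, 'k::field) alg_op \<Rightarrow> ('v, 'k) alg_op \<Rightarrow> ('v, 'k) alg_op" where
  "lie_bracket D E = (\<lambda>f. D (E f) - E (D f))"

global_interpretation op: vector_space "op_scale :: 'k::field \<Rightarrow> ('v, 'k) alg_op \<Rightarrow> ('v, 'k) alg_op"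
proof
  fix a b :: 'k and x y :: "('v, 'k) alg_op"
  show "op_scale a (x + y) = op_scale a x + op_scale a y"
    by (simp add: op_scale_def scalar_mult_def fun_eq_iff distrib_left)
  show "op_scale (a + b) x = op_scale a x + op_scale b x"
    by (simp add: op_scale_def scalar_mult_def fun_eq_iff single_add distrib_right)
  show "op_scale a (op_scale b x) = op_scale (a * b) x"
    by (simp add: op_scale_def scalar_mult_def fun_eq_iff mult_single flip: mult.assoc)
  show "op_scale 1 x = x"
    by (simp add: op_scale_def scalar_mult_def fun_eq_iff)
qed

definition derivations :: "('v \<Rightarrow> rat) set \<Rightarrow> ('v, 'k::field) alg_op set" where
  "derivations S = {D.
     (\<forall>f. f \<notin> coord_ring S \<longrightarrow> D f = 0) \<and>
     (\<forall>f\<in>coord_ring S. D f \<in> coord_ring S) \<and>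
     (\<forall>f\<in>coord_ring S. \<forall>g\<in>coord_ring S. D (f + g) = D f + D g) \<and>
     (\<forall>c. \<forall>f\<in>coord_ring S. D (scalar_mult c f) = scalar_mult c (D f)) \<and>
     (\<forall>f\<in>coord_ring S. \<forall>g\<in>coord_ring S. D (f * g) = D f * g + f * D g)}"

definition lie_subalgebra :: "('v \<Rightarrow> rat) set \<Rightarrow> ('v, 'k::field) alg_op set \<Rightarrow> bool" where
  "lie_subalgebra S L \<longleftrightarrow>
     L \<subseteq> derivations S \<and> op.subspace L \<and> (\<forall>D\<in>L. \<forall>E\<in>L. lie_bracket D E \<in> L)"

definition lie_generated ::
    "('v \<Rightarrow> rat) set \<Rightarrow> ('v, 'k::field) alg_op set \<Rightarrow> ('v, 'k) alg_op set" where
  "lie_generated S G = lie_subalgebra S hull G"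

definition lie_finite_dim :: "('v, 'k::field) alg_op set \<Rightarrow> bool" where
  "lie_finite_dim L \<longleftrightarrow> (\<exists>B. finite B \<and> op.span B = L)"

primrec lower_central_series ::
    "('v, 'k::field) alg_op set \<Rightarrow> nat \<Rightarrow> ('v, 'k) alg_op set" where
  "lower_central_series L 0 = L"
| "lower_central_series L (Suc n) =
     op.span {lie_bracket D E | D E. D \<in> L \<and> E \<in> lower_central_series L n}"

definition lie_nilpotent :: "('v, 'k::field) alg_op set \<Rightarrow> bool" where
  "lie_nilpotent L \<longleftrightarrow> (\<exists>n. lower_central_series L n = {0})"

text \<open>
  Below, \<open>M\<close> is the dual lattice, \<open>S\<close> the monoid \<open>\<Delta>\<^sup>\<or>\<close> and \<open>\<rho> 1, \<dots>, \<rho> k\<close> the ray generators;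
  \<open>L\<close> is a Lie algebra of derivations of \<open>\<O>(X)\<close>.
\<close>

definition demazure_roots ::
    "('v \<Rightarrow> rat) set \<Rightarrow> (nat \<Rightarrow> 'v) \<Rightarrow> nat \<Rightarrow> nat \<Rightarrow> ('v \<Rightarrow> rat) set" where
  "demazure_roots M \<rho> k j = {e \<in> M. e (\<rho> j) = -1 \<and> (\<forall>i\<in>{1..k} - {j}. 0 \<le> e (\<rho> i))}"

definition root_derivation ::
    "('v \<Rightarrow> rat) set \<Rightarrow> 'v \<Rightarrow> ('v \<Rightarrow> rat) \<Rightarrow> ('v, 'k::field_char_0) alg_op" where
  "root_derivation S v e = (\<lambda>f.
     if f \<in> coord_ring S
     then \<Sum>m\<in>Poly_Mapping.keys f. Poly_Mapping.single (m + e) (Poly_Mapping.lookup f m * of_rat (m v))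
     else 0)"

definition root_derivations ::
    "('v \<Rightarrow> rat) set \<Rightarrow> ('v \<Rightarrow> rat) set \<Rightarrow> (nat \<Rightarrow> 'v) \<Rightarrow> nat \<Rightarrow> ('v, 'k::field_char_0) alg_op set" where
  "root_derivations M S \<rho> k =
     {root_derivation S (\<rho> j) e | j e. j \<in> {1..k} \<and> e \<in> demazure_roots M \<rho> k j}"

text \<open>The set \<open>R\<^sub>i\<close>, and the subalgebra \<open>L\<^sub>i\<close>.\<close>

definition roots_of ::
    "('v \<Rightarrow> rat) set \<Rightarrow> ('v \<Rightarrow> rat) set \<Rightarrow> (nat \<Rightarrow> 'v) \<Rightarrow> nat \<Rightarrow> ('v, 'k::field_char_0) alg_op set
      \<Rightarrow> nat \<Rightarrow> ('v \<Rightarrow> rat) set" where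
  "roots_of M S \<rho> k L i = {e \<in> demazure_roots M \<rho> k i. root_derivation S (\<rho> i) e \<in> L}"

definition root_subalgebra ::
    "('v \<Rightarrow> rat) set \<Rightarrow> ('v \<Rightarrow> rat) set \<Rightarrow> (nat \<Rightarrow> 'v) \<Rightarrow> nat \<Rightarrow> ('v, 'k::field_char_0) alg_op set
      \<Rightarrow> nat \<Rightarrow> ('v, 'k) alg_op set" where
  "root_subalgebra M S \<rho> k L i =
     lie_generated S (root_derivation S (\<rho> i) ` roots_of M S \<rho> k L i)"

definition contains_two_cycle ::
    "('v \<Rightarrow> rat) set \<Rightarrow> ('v \<Rightarrow> rat) set \<Rightarrow> (nat \<Rightarrow> 'v) \<Rightarrow> nat \<Rightarrow> ('v, 'k::field_char_0) alg_op set
      \<Rightarrow> bool" where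
  "contains_two_cycle M S \<rho> k L \<longleftrightarrow>
     (\<exists>i\<in>{1..k}. \<exists>j\<in>{1..k}. \<exists>e\<in>roots_of M S \<rho> k L i. \<exists>e'\<in>roots_of M S \<rho> k L j.
        e (\<rho> j) > 0 \<and> e' (\<rho> i) > 0)"

definition root_graph ::
    "('v \<Rightarrow> rat) set \<Rightarrow> ('v \<Rightarrow> rat) set \<Rightarrow> (nat \<Rightarrow> 'v) \<Rightarrow> nat \<Rightarrow> nat \<Rightarrow> ('v, 'k::field_char_0) alg_op set
      \<Rightarrow> ('v, 'k) alg_op set pair_pre_digraph" where
  "root_graph M S \<rho> k r L =
     \<lparr> pverts = root_subalgebra M S \<rho> k L ` {1..r},
       parcs = {(root_subalgebra M S \<rho> k L j, root_subalgebra M S \<rho> k L i) | i j.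
                  i \<in> {1..r} \<and> j \<in> {1..r} \<and> (\<exists>e\<in>roots_of M S \<rho> k L i. e (\<rho> j) > 0)} \<rparr>"

definition has_oriented_cycle :: "'a pair_pre_digraph \<Rightarrow> bool" where
  "has_oriented_cycle G \<longleftrightarrow> (\<exists>p. pre_digraph.cycle (with_proj G) p)"

end

theory Submission
  imports Defs
begin

text \<open>
  Without 2-cycles, the bracket of two root derivations \<open>\<partial>\<^sub>\<rho>\<^sub>i\<^sub>,\<^sub>e\<close> and \<open>\<partial>\<^sub>\<rho>\<^sub>j\<^sub>,\<^sub>e\<^sub>'\<close> in \<open>L\<close> is zero or a
  multiple of a root derivation of degree \<open>e + e'\<close>. It follows that \<open>L\<close> is spanned by root
  derivations, and that the edge relation is transitive: if \<open>e' \<in> R\<^sub>l\<close> is positive on \<open>\<rho>\<^sub>j\<close> and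
  \<open>e \<in> R\<^sub>j\<close> is positive on \<open>\<rho>\<^sub>i\<close>, then \<open>e + e' \<in> R\<^sub>l\<close> is positive on \<open>\<rho>\<^sub>i\<close>. Being irreflexive, it is
  a strict partial order. Hence there are positive weights \<open>w\<close>, growing fast along this order,
  for which \<open>\<Phi> e = (\<Sum>l. w l * e (\<rho> l))\<close> is at most \<open>-1\<close> on the roots of the finitely many
  generators. A bracket of \<open>n\<close> generators has \<open>\<Phi> \<le> -n\<close>, whereas \<open>\<Phi> \<ge> - w i\<close> on \<open>R\<^sub>i\<close>; so long
  brackets vanish, which gives both finite dimension and nilpotency.

  That the root derivations preserve \<open>\<O>(X)\<close> and that distinct \<open>L\<^sub>i\<close> are distinct subalgebras
  depends on two facts of convex geometry: a pointed polyhedral cone is generated by its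
  extremal rays, and each of them is positive under some element of \<open>\<Delta>\<^sup>\<or>\<close>.
\<close>

section \<open>Homogeneous derivations\<close>

text \<open>The formula of \<open>root_derivation\<close> on the whole ambient algebra, so that
  identities can be checked without conditions on supports.\<close>

definition monomial_deriv :: "'v \<Rightarrow> ('v \<Rightarrow> rat) \<Rightarrow> ('v, 'k::field_char_0) alg_op" where
  "monomial_deriv v e f =
     (\<Sum>m\<in>Poly_Mapping.keys f. Poly_Mapping.single (m + e) (Poly_Mapping.lookup f m * of_rat (m v)))"

lemma monomial_deriv_superset:
  assumes "finite A" "Poly_Mapping.keys f \<subseteq> A"
  shows "monomial_deriv v e f =
    (\<Sum>m\<in>A. Poly_Mapping.single (m + e) (Poly_Mapping.lookup f m * of_rat (m v)))"
  unfolding monomial_deriv_def using assms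
  by (intro sum.mono_neutral_left) (auto simp: in_keys_iff)

lemma monomial_deriv_add:
  "monomial_deriv v e (f + g) = monomial_deriv v e f + monomial_deriv v e g"
proof -
  let ?A = "Poly_Mapping.keys f \<union> Poly_Mapping.keys g"
  have *: "finite ?A" "Poly_Mapping.keys (f + g) \<subseteq> ?A" by (auto simp: keys_add)
  show ?thesis
    using * by (subst (1 2 3) monomial_deriv_superset[of ?A])
      (auto simp: lookup_add distrib_right single_add sum.distrib)
qed

lemma monomial_deriv_single [simp]:
  "monomial_deriv v e (Poly_Mapping.single m c) = Poly_Mapping.single (m + e) (c * of_rat (m v))"
  by (subst monomial_deriv_superset[of "{m}"]) auto

lemma monomial_deriv_0 [simp]: "monomial_deriv v e 0 = 0"
  by (simp add: monomial_deriv_def)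

text \<open>Reduces the Leibniz rule and the commutator formula to characters, where they become
  identities of coefficients.\<close>

lemma additive_ext:
  fixes F G :: "('a \<Rightarrow>\<^sub>0 'b::comm_monoid_add) \<Rightarrow> 'c::cancel_comm_monoid_add"
  assumes F: "\<And>f g. F (f + g) = F f + F g" and G: "\<And>f g. G (f + g) = G f + G g"
    and single: "\<And>m c. F (Poly_Mapping.single m c) = G (Poly_Mapping.single m c)"
  shows "F f = G f"
proof (induction f rule: update_induct)
  case const
  \<comment> \<open>The zero element is a monomial with coefficient 0, at an arbitrary
    exponent.\<close>
  show ?case using single[of undefined 0] by simp
next
  case (update f a b)
  have "Poly_Mapping.update a b f = f + Poly_Mapping.single a b"
    using update(1) by (intro poly_mapping_eqI)
      (auto simp: lookup_update lookup_add lookup_single in_keys_iff when_def)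
  then show ?case using update by (simp add: F G single)
qed

lemma monomial_deriv_Leibniz:
  "monomial_deriv v e (f * g) = monomial_deriv v e f * g + f * monomial_deriv v e g"
proof (rule additive_ext[where f = f])
  fix m c
  show "monomial_deriv v e (Poly_Mapping.single m c * g) =
      monomial_deriv v e (Poly_Mapping.single m c) * g
      + Poly_Mapping.single m c * monomial_deriv v e g"
    by (rule additive_ext[where f = g])
      (simp_all add: monomial_deriv_add algebra_simps mult_single of_rat_add flip: single_add)
qed (simp_all add: monomial_deriv_add algebra_simps)

text \<open>Scalars sit in degree 0, and the zero form vanishes on \<open>v\<close>, so this is the
  Leibniz rule with a constant first factor.\<close>

lemma monomial_deriv_scalar:
  "monomial_deriv v e (scalar_mult c f) = scalar_mult c (monomial_deriv v e f)"
  unfolding scalar_mult_def by (simp add: monomial_deriv_Leibniz)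

text \<open>On the character of \<open>m\<close> the two compositions have the same degree and the
  coefficients \<open>m v * (m + e') u\<close> and \<open>m u * (m + e) v\<close>; the products
  \<open>m u * m v\<close> cancel.\<close>

lemma monomial_deriv_comm:
  "monomial_deriv u e (monomial_deriv v e' f) - monomial_deriv v e' (monomial_deriv u e f) =
     scalar_mult (of_rat (e' u)) (monomial_deriv v (e + e') f)
     - scalar_mult (of_rat (e v)) (monomial_deriv u (e + e') f)"
proof (rule additive_ext[where f = f])
  fix m c
  have "m + e' + e = m + (e + e')" "m + e + e' = m + (e + e')"
    by (simp_all add: algebra_simps)
  then show "monomial_deriv u e (monomial_deriv v e' (Poly_Mapping.single m c))
      - monomial_deriv v e' (monomial_deriv u e (Poly_Mapping.single m c)) =
     scalar_mult (of_rat (e' u)) (monomial_deriv v (e + e') (Poly_Mapping.single m c))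
     - scalar_mult (of_rat (e v)) (monomial_deriv u (e + e') (Poly_Mapping.single m c))"
    by (simp add: scalar_mult_def mult_single of_rat_add algebra_simps flip: single_diff single_add)
qed (simp_all add: monomial_deriv_add scalar_mult_def algebra_simps)

section \<open>The coordinate ring and the Lie algebra of its derivations\<close>

lemma coord_ring_0 [simp]: "0 \<in> coord_ring S"
  by (simp add: coord_ring_def)

lemma coord_ring_add: "f \<in> coord_ring S \<Longrightarrow> g \<in> coord_ring S \<Longrightarrow> f + g \<in> coord_ring S"
  using keys_add[of f g] by (auto simp: coord_ring_def)

lemma coord_ring_minus: "f \<in> coord_ring S \<Longrightarrow> - f \<in> coord_ring S"
  by (simp add: coord_ring_def)

lemma coord_ring_diff: "f \<in> coord_ring S \<Longrightarrow> g \<in> coord_ring S \<Longrightarrow> f - g \<in> coord_ring S"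
  using coord_ring_add[of f S "- g"] by (simp add: coord_ring_minus)

lemma coord_ring_scalar: "f \<in> coord_ring S \<Longrightarrow> scalar_mult c f \<in> coord_ring S"
  using keys_mult[of "Poly_Mapping.single 0 c" f]
  by (fastforce simp: coord_ring_def scalar_mult_def split: if_splits)

lemma coord_ring_sum: "(\<And>x. x \<in> A \<Longrightarrow> f x \<in> coord_ring S) \<Longrightarrow> sum f A \<in> coord_ring S"
  by (induction A rule: infinite_finite_induct) (auto intro: coord_ring_add)

lemma coord_ring_mult:
  assumes "\<And>m m'. m \<in> S \<Longrightarrow> m' \<in> S \<Longrightarrow> m + m' \<in> S" "f \<in> coord_ring S" "g \<in> coord_ring S"
  shows "f * g \<in> coord_ring S"
  using assms keys_mult[of f g] by (fastforce simp: coord_ring_def)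

lemma derivation_add:
  "D \<in> derivations S \<Longrightarrow> f \<in> coord_ring S \<Longrightarrow> g \<in> coord_ring S \<Longrightarrow> D (f + g) = D f + D g"
  and derivation_outside: "D \<in> derivations S \<Longrightarrow> f \<notin> coord_ring S \<Longrightarrow> D f = 0"
  and derivation_scalar:
  "D \<in> derivations S \<Longrightarrow> f \<in> coord_ring S \<Longrightarrow> D (scalar_mult c f) = scalar_mult c (D f)"
  and derivation_Leibniz:
  "D \<in> derivations S \<Longrightarrow> f \<in> coord_ring S \<Longrightarrow> g \<in> coord_ring S \<Longrightarrow> D (f * g) = D f * g + f * D g"
  by (simp_all add: derivations_def)

lemma derivation_closed: "D \<in> derivations S \<Longrightarrow> D f \<in> coord_ring S"
  by (cases "f \<in> coord_ring S") (simp_all add: derivations_def)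

lemma derivation_0 [simp]: "D \<in> derivations S \<Longrightarrow> D 0 = 0"
  using derivation_add[of D S 0 0] by simp

lemma scalar_mult_simps:
  "scalar_mult c (f + g) = scalar_mult c f + scalar_mult c g"
  "scalar_mult c (f - g) = scalar_mult c f - scalar_mult c g"
  "scalar_mult c 0 = 0"
  "scalar_mult c (scalar_mult d f) = scalar_mult d (scalar_mult c f)"
  "scalar_mult c f * g = scalar_mult c (f * g)"
  "f * scalar_mult c g = scalar_mult c (f * g)"
  by (simp_all add: scalar_mult_def algebra_simps)

lemma derivationsI:
  assumes "\<And>f. f \<notin> coord_ring S \<Longrightarrow> D f = 0"
    and "\<And>f. f \<in> coord_ring S \<Longrightarrow> D f \<in> coord_ring S"
    and "\<And>f g. f \<in> coord_ring S \<Longrightarrow> g \<in> coord_ring S \<Longrightarrow> D (f + g) = D f + D g"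
    and "\<And>c f. f \<in> coord_ring S \<Longrightarrow> D (scalar_mult c f) = scalar_mult c (D f)"
    and "\<And>f g. f \<in> coord_ring S \<Longrightarrow> g \<in> coord_ring S \<Longrightarrow> D (f * g) = D f * g + f * D g"
  shows "D \<in> derivations S"
  using assms by (simp add: derivations_def)

lemma lie_subalgebra_derivations:
  fixes S :: "('v \<Rightarrow> rat) set"
  assumes S: "\<And>m m'. m \<in> S \<Longrightarrow> m' \<in> S \<Longrightarrow> m + m' \<in> S"
  shows "lie_subalgebra S (derivations S :: ('v, 'k::field) alg_op set)"
proof -
  note mult = coord_ring_mult[OF S]
  have "op.subspace (derivations S :: ('v, 'k) alg_op set)"
    unfolding op.subspace_def
  proof safe
    show "(0 :: ('v, 'k) alg_op) \<in> derivations S"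
      by (simp add: derivations_def scalar_mult_def)
  next
    fix D E :: "('v, 'k) alg_op" assume "D \<in> derivations S" "E \<in> derivations S"
    then show "D + E \<in> derivations S"
      by (intro derivationsI)
        (simp_all add: derivation_outside derivation_closed coord_ring_add derivation_add
          derivation_scalar scalar_mult_simps derivation_Leibniz algebra_simps)
  next
    fix D :: "('v, 'k) alg_op" and c assume "D \<in> derivations S"
    then show "op_scale c D \<in> derivations S"
      by (intro derivationsI) (simp_all add: op_scale_def derivation_outside derivation_closed
          coord_ring_scalar derivation_add derivation_scalar scalar_mult_simps derivation_Leibniz)
  qed
  moreover have "lie_bracket D E \<in> derivations S"
    if D: "D \<in> derivations S" and E: "E \<in> derivations S" for D E :: "('v, 'k) alg_op"
  proof (rule derivationsI)
    fix f g :: "('v, 'k) char_alg" assume fg: "f \<in> coord_ring S" "g \<in> coord_ring S"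
    \<comment> \<open>The two mixed terms are symmetric in \<open>D'\<close> and \<open>E'\<close>,
      so they cancel in the commutator.\<close>
    have "D' (E' (f * g)) = D' (E' f) * g + E' f * D' g + D' f * E' g + f * D' (E' g)"
      if "D' \<in> derivations S" "E' \<in> derivations S" for D' E' :: "('v, 'k) alg_op"
      using that fg by (simp add: derivation_Leibniz derivation_add derivation_closed mult)
    from this[OF D E] this[OF E D]
    show "lie_bracket D E (f * g) = lie_bracket D E f * g + f * lie_bracket D E g"
      by (simp add: lie_bracket_def left_diff_distrib right_diff_distrib)
  qed (use D E in \<open>simp_all add: lie_bracket_def derivation_outside derivation_closed
      coord_ring_diff derivation_add derivation_scalar scalar_mult_simps\<close>)
  ultimately show ?thesis by (simp add: lie_subalgebra_def)
qed

text \<open>The closure conditions pass to intersections, and the member \<open>D\<close> of the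
  family keeps the intersection inside \<open>derivations S\<close>.\<close>

lemma lie_subalgebra_generated:
  assumes "lie_subalgebra S D" "G \<subseteq> D"
  shows "lie_subalgebra S (lie_generated S G)"
proof -
  let ?F = "{T. lie_subalgebra S T \<and> G \<subseteq> T}"
  have "op.subspace (\<Inter>?F)"
    by (rule op.subspace_Inter) (simp add: lie_subalgebra_def)
  moreover have "\<Inter>?F \<subseteq> derivations S"
    using assms by (auto simp: lie_subalgebra_def)
  moreover have "\<forall>D\<in>\<Inter>?F. \<forall>E\<in>\<Inter>?F. lie_bracket D E \<in> \<Inter>?F"
    by (auto simp: lie_subalgebra_def)
  ultimately show ?thesis
    unfolding lie_generated_def hull_def lie_subalgebra_def[of S "\<Inter>_"] by blast
qed

lemma lie_bracket_skew: "lie_bracket D E = - lie_bracket E D"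
  by (simp add: lie_bracket_def fun_eq_iff)

lemma lie_bracket_linear_right:
  assumes "D \<in> derivations S" "E \<in> derivations S" "F \<in> derivations S"
  shows "lie_bracket D (op_scale c E + F) = op_scale c (lie_bracket D E) + lie_bracket D F"
proof
  fix f
  have "D (scalar_mult c (E f) + F f) = scalar_mult c (D (E f)) + D (F f)"
    using assms by (simp add: derivation_add derivation_scalar derivation_closed coord_ring_scalar)
  then show "lie_bracket D (op_scale c E + F) f = (op_scale c (lie_bracket D E) + lie_bracket D F) f"
    by (simp add: lie_bracket_def op_scale_def scalar_mult_simps)
qed

text \<open>Membership in \<open>derivations S\<close> is carried along because the induction step
  applies \<open>lie_bracket_linear_right\<close>, which is about derivations.\<close>

lemma lie_bracket_span_right:
  fixes S :: "('v \<Rightarrow> rat) set" and D E :: "('v, 'k::field) alg_op"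
  assumes S: "\<And>m m'. m \<in> S \<Longrightarrow> m' \<in> S \<Longrightarrow> m + m' \<in> S"
    and D: "D \<in> derivations S" and Y: "Y \<subseteq> derivations S" and V: "op.subspace V"
    and DY: "\<And>E. E \<in> Y \<Longrightarrow> lie_bracket D E \<in> V" and E: "E \<in> op.span Y"
  shows "E \<in> derivations S \<and> lie_bracket D E \<in> V"
  using E
proof (induction rule: op.span_induct_alt)
  case base
  have "lie_bracket D 0 = 0" using D by (simp add: lie_bracket_def fun_eq_iff)
  then show ?case using V lie_subalgebra_derivations[OF S, where 'k = 'k]
    unfolding lie_subalgebra_def by (metis op.subspace_0)
next
  case (step c E F)
  then have E: "E \<in> derivations S" using Y by auto
  have "op_scale c E + F \<in> derivations S"
    using lie_subalgebra_derivations[OF S, where 'k = 'k] step.IH E unfolding lie_subalgebra_def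
    by (intro op.subspace_add op.subspace_scale) simp_all
  moreover have "lie_bracket D (op_scale c E + F) \<in> V"
    using step.IH lie_bracket_linear_right[OF D E, of F c] DY[OF step.hyps]
      op.subspace_add[OF V op.subspace_scale[OF V]] by simp
  ultimately show ?case ..
qed

lemma lie_bracket_span:
  fixes S :: "('v \<Rightarrow> rat) set" and D E :: "('v, 'k::field) alg_op"
  assumes S: "\<And>m m'. m \<in> S \<Longrightarrow> m' \<in> S \<Longrightarrow> m + m' \<in> S"
    and X: "X \<subseteq> derivations S" and Y: "Y \<subseteq> derivations S" and V: "op.subspace V"
    and XY: "\<And>D E. D \<in> X \<Longrightarrow> E \<in> Y \<Longrightarrow> lie_bracket D E \<in> V"
    and D: "D \<in> op.span X" and E: "E \<in> op.span Y"
  shows "lie_bracket D E \<in> V"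
proof -
  have skew: "lie_bracket F G \<in> V \<Longrightarrow> lie_bracket G F \<in> V" for F G
    using lie_bracket_skew[of G F] op.subspace_neg[OF V] by simp
  have "lie_bracket F E \<in> V" if "F \<in> X" for F
    using lie_bracket_span_right[OF S _ Y V _ E, of F] XY that X by auto
  moreover have "E \<in> derivations S"
    using op.span_minimal[OF Y] lie_subalgebra_derivations[OF S, where 'k = 'k] E
    unfolding lie_subalgebra_def by blast
  \<comment> \<open>The left argument is reached from the right one by skew symmetry.\<close>
  ultimately show ?thesis
    using lie_bracket_span_right[OF S _ X V _ D, of E] skew by blast
qed

section \<open>Lie algebras of root derivations\<close>

lemma root_derivation_monomial_deriv:
  "root_derivation S v e f = (if f \<in> coord_ring S then monomial_deriv v e f else 0)"
  by (simp add: root_derivation_def monomial_deriv_def)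

text \<open>Take \<open>w i = K ^ n\<close>, where \<open>n\<close> counts the elements below
  \<open>i\<close> and \<open>K = 1 + card I * C\<close>. Elements below \<open>i\<close> have a
  smaller count, so for \<open>n > 0\<close> the sum is at most
  \<open>card I * C * K ^ (n - 1)\<close>, and adding \<open>1 \<le> K ^ (n - 1)\<close> gives at
  most \<open>K ^ n\<close>.\<close>

lemma exists_decreasing_weights:
  fixes less :: "nat \<Rightarrow> nat \<Rightarrow> bool" and C :: rat
  assumes I: "finite I" and C: "C \<ge> 0"
    and irrefl: "\<And>i. i \<in> I \<Longrightarrow> \<not> less i i"
    and trans: "\<And>i j l. i \<in> I \<Longrightarrow> j \<in> I \<Longrightarrow> l \<in> I \<Longrightarrow> less i j \<Longrightarrow> less j l \<Longrightarrow> less i l"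
  shows "\<exists>w. (\<forall>i. w i > (0::rat)) \<and> (\<forall>i\<in>I. w i \<ge> 1 + (\<Sum>l | l \<in> I \<and> less l i. C * w l))"
proof (intro exI conjI allI ballI)
  let ?K = "1 + of_nat (card I) * C"
  let ?rank = "\<lambda>i. card {l \<in> I. less l i}"
  define w where "w i = ?K ^ ?rank i" for i
  have K: "?K \<ge> 1" using C by simp
  then show "w i > 0" for i unfolding w_def by simp
  fix i assume i: "i \<in> I"
  show "w i \<ge> 1 + (\<Sum>l | l \<in> I \<and> less l i. C * w l)"
  proof (cases "?rank i")
    case 0
    then have empty: "{l \<in> I. less l i} = {}" using I by simp
    show ?thesis unfolding w_def empty by simp
  next
    case (Suc n)
    have "w l \<le> ?K ^ n" if l: "l \<in> I" "less l i" for l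
    proof -
      have "{j \<in> I. less j l} \<subset> {j \<in> I. less j i}"
        using l i irrefl trans by blast
      then have "?rank l < ?rank i" using I by (intro psubset_card_mono) auto
      then show ?thesis unfolding w_def using K Suc by (intro power_increasing) auto
    qed
    then have "(\<Sum>l | l \<in> I \<and> less l i. C * w l) \<le> of_nat (?rank i) * (C * ?K ^ n)"
      using C by (intro sum_bounded_above) (auto intro: mult_left_mono)
    also have "\<dots> \<le> of_nat (card I) * (C * ?K ^ n)"
      using I C K by (intro mult_right_mono) (auto intro: card_mono)
    finally have "1 + (\<Sum>l | l \<in> I \<and> less l i. C * w l) \<le> ?K ^ n + of_nat (card I) * C * ?K ^ n"
      using one_le_power[OF K, of n] by (simp add: algebra_simps)
    also have "\<dots> = w i" unfolding w_def Suc by (simp add: algebra_simps)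
    finally show ?thesis .
  qed
qed

text \<open>Collects what the Lie algebra argument takes from convex geometry:
  \<open>S_shift\<close> makes root derivations preserve the coordinate ring, and
  \<open>S_nontrivial\<close> makes them nonzero. The instance comes from
  \<open>root_datum_ray_generators\<close>.\<close>

locale root_datum =
  fixes M S :: "('v \<Rightarrow> rat) set" and \<rho> :: "nat \<Rightarrow> 'v" and k :: nat
  assumes M_add: "e \<in> M \<Longrightarrow> e' \<in> M \<Longrightarrow> e + e' \<in> M"
    and M_int: "e \<in> M \<Longrightarrow> i \<in> {1..k} \<Longrightarrow> e (\<rho> i) \<in> \<int>"
    and S_add: "m \<in> S \<Longrightarrow> m' \<in> S \<Longrightarrow> m + m' \<in> S"
    and S_shift: "m \<in> S \<Longrightarrow> i \<in> {1..k} \<Longrightarrow> e \<in> demazure_roots M \<rho> k i \<Longrightarrow> m (\<rho> i) \<noteq> 0 \<Longrightarrow> m + e \<in> S"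
    and S_nontrivial: "i \<in> {1..k} \<Longrightarrow> \<exists>m\<in>S. m (\<rho> i) \<noteq> 0"
begin

text \<open>A character with \<open>m (\<rho> i) = 0\<close> is killed, and \<open>S_shift\<close>
  applies to every other one.\<close>

lemma monomial_deriv_closed:
  assumes "i \<in> {1..k}" "e \<in> demazure_roots M \<rho> k i" "f \<in> coord_ring S"
  shows "monomial_deriv (\<rho> i) e f \<in> coord_ring S"
  unfolding monomial_deriv_def using assms
  by (intro coord_ring_sum) (auto simp: coord_ring_def intro!: S_shift)

lemma root_derivation_in_derivations:
  assumes "i \<in> {1..k}" "e \<in> demazure_roots M \<rho> k i"
  shows "root_derivation S (\<rho> i) e \<in> derivations S"
  using monomial_deriv_closed[OF assms]
  by (intro derivationsI) (simp_all add: root_derivation_monomial_deriv coord_ring_add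
      coord_ring_scalar coord_ring_mult S_add monomial_deriv_add monomial_deriv_scalar
      monomial_deriv_Leibniz)

lemma lie_generated_root_derivations:
  assumes "G \<subseteq> root_derivations M S \<rho> k"
  shows "lie_subalgebra S (lie_generated S G)"
proof (rule lie_subalgebra_generated)
  show "lie_subalgebra S (derivations S)" by (rule lie_subalgebra_derivations[OF S_add])
  show "G \<subseteq> derivations S"
    using assms by (auto simp: root_derivations_def root_derivation_in_derivations dest!: subsetD)
qed

text \<open>The sum \<open>e + e'\<close> need not be a Demazure root; the right-hand side uses only
  the formula of \<open>root_derivation\<close>.\<close>

lemma lie_bracket_root_derivation:
  assumes "i \<in> {1..k}" "e \<in> demazure_roots M \<rho> k i" "j \<in> {1..k}" "e' \<in> demazure_roots M \<rho> k j"
  shows "lie_bracket (root_derivation S (\<rho> i) e) (root_derivation S (\<rho> j) e') =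
    op_scale (of_rat (e' (\<rho> i))) (root_derivation S (\<rho> j) (e + e'))
    - op_scale (of_rat (e (\<rho> j))) (root_derivation S (\<rho> i) (e + e'))"
  using monomial_deriv_closed[OF assms(1,2)] monomial_deriv_closed[OF assms(3,4)]
  by (auto simp: fun_eq_iff lie_bracket_def op_scale_def root_derivation_monomial_deriv
      monomial_deriv_comm scalar_mult_simps)

lemma demazure_root_diag: "e \<in> demazure_roots M \<rho> k i \<Longrightarrow> e (\<rho> i) = -1"
  and demazure_root_nonneg:
  "e \<in> demazure_roots M \<rho> k i \<Longrightarrow> j \<in> {1..k} \<Longrightarrow> j \<noteq> i \<Longrightarrow> 0 \<le> e (\<rho> j)"
  by (auto simp: demazure_roots_def)

text \<open>The critical ray is \<open>\<rho> i\<close>, where \<open>e\<close> contributes -1; by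
  integrality \<open>e'\<close> contributes at least 1 there.\<close>

lemma demazure_root_add:
  assumes "i \<in> {1..k}" "j \<in> {1..k}"
    and e: "e \<in> demazure_roots M \<rho> k i" and e': "e' \<in> demazure_roots M \<rho> k j"
    and "e (\<rho> j) = 0" "e' (\<rho> i) > 0"
  shows "e + e' \<in> demazure_roots M \<rho> k j"
proof -
  have "e' (\<rho> i) \<in> \<int>" using e' assms(1) M_int by (auto simp: demazure_roots_def)
  then have "e' (\<rho> i) \<ge> 1" using assms by (auto elim!: Ints_cases)
  moreover have "0 \<le> (e + e') (\<rho> l)" if "l \<in> {1..k}" "l \<noteq> i" "l \<noteq> j" for l
    using demazure_root_nonneg e e' that by simp
  ultimately have "0 \<le> (e + e') (\<rho> l)" if "l \<in> {1..k}" "l \<noteq> j" for l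
    using that demazure_root_diag[OF e] by (cases "l = i") auto
  then show ?thesis
    using assms by (auto simp: demazure_roots_def M_add)
qed

text \<open>The roots \<open>e\<close> separate the subalgebras: \<open>e (\<rho> i) = -1\<close> for \<open>e\<close> in \<open>R\<^sub>i\<close>, while \<open>e (\<rho> i) \<ge> 0\<close>
  for \<open>e\<close> in any other \<open>R\<^sub>j\<close>, and \<open>e\<close> is the degree of \<open>\<partial>\<^sub>\<rho>\<^sub>,\<^sub>e\<close> in the grading by characters.\<close>

lemma root_subalgebra_inj:
  fixes L :: "('v, 'k::field_char_0) alg_op set"
  assumes i: "i \<in> {1..k}" and j: "j \<in> {1..k}" and ne: "roots_of M S \<rho> k L i \<noteq> {}"
    and eq: "root_subalgebra M S \<rho> k L i = root_subalgebra M S \<rho> k L j"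
  shows "i = j"
proof (rule ccontr)
  assume ij: "i \<noteq> j"
  let ?X = "root_derivation S (\<rho> j) ` roots_of M S \<rho> k L j :: ('v, 'k) alg_op set"
  have X: "?X \<subseteq> derivations S"
    using j by (auto simp: roots_of_def root_derivation_in_derivations)
  \<comment> \<open>Two roots of the same ray both take the value -1 on it, so the two terms of
    their bracket cancel. Hence the span is already a subalgebra and contains the one generated by
    \<open>?X\<close>.\<close>
  have "lie_bracket D E \<in> {0}" if "D \<in> op.span ?X" "E \<in> op.span ?X"
    for D E :: "('v, 'k) alg_op"
  proof (rule lie_bracket_span[OF S_add X X op.subspace_single_0 _ that])
    fix D E :: "('v, 'k) alg_op" assume "D \<in> ?X" "E \<in> ?X"
    then show "lie_bracket D E \<in> {0}"
      using j by (auto simp: roots_of_def lie_bracket_root_derivation demazure_root_diag)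
  qed
  then have "\<forall>D\<in>op.span ?X. \<forall>E\<in>op.span ?X. lie_bracket D E \<in> op.span ?X"
    by (simp add: op.span_zero)
  then have "lie_subalgebra S (op.span ?X)"
    using op.span_minimal[OF X] lie_subalgebra_derivations[OF S_add, where 'k = 'k]
    unfolding lie_subalgebra_def by (simp add: op.subspace_span)
  then have sub: "root_subalgebra M S \<rho> k L j \<subseteq> op.span ?X"
    unfolding root_subalgebra_def lie_generated_def by (intro hull_minimal op.span_superset)
  obtain e where e: "e \<in> roots_of M S \<rho> k L i" using ne by auto
  \<comment> \<open>By this choice, the derivation of \<open>i\<close> and \<open>e\<close> has a
    nonzero component in degree \<open>m + e\<close> on the character of \<open>m\<close>, where
    elements of \<open>op.span ?X\<close> have none.\<close>
  obtain m where m: "m \<in> S" "m (\<rho> i) \<noteq> 0" using S_nontrivial[OF i] by auto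
  let ?\<chi> = "Poly_Mapping.single m 1 :: ('v, 'k) char_alg"
  have \<chi>: "?\<chi> \<in> coord_ring S" using m by (simp add: coord_ring_def)
  have "root_derivation S (\<rho> i) e \<in> root_subalgebra M S \<rho> k L i"
    unfolding root_subalgebra_def lie_generated_def using e by (intro hull_inc imageI)
  then have "root_derivation S (\<rho> i) e \<in> op.span ?X" using eq sub by auto
  moreover have "Poly_Mapping.lookup (D ?\<chi>) (m + e) = 0" if "D \<in> op.span ?X"
    for D :: "('v, 'k) alg_op"
    using that
  proof (induction rule: op.span_induct_alt)
    case base show ?case by simp
  next
    case (step c D E)
    then obtain e' where D: "D = root_derivation S (\<rho> j) e'" and e': "e' \<in> roots_of M S \<rho> k L j"
      by auto
    have "e' (\<rho> i) \<ge> 0" using e' i ij demazure_root_nonneg[of e' j i] by (auto simp: roots_of_def)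
    then have "e \<noteq> e'" using e demazure_root_diag[of e i] by (auto simp: roots_of_def)
    then have "m + e' \<noteq> m + e" by (metis add_left_cancel)
    moreover have "(op_scale c D + E) ?\<chi> =
        Poly_Mapping.single (m + e') (c * of_rat (m (\<rho> j))) + E ?\<chi>"
      using \<chi> by (simp add: D op_scale_def root_derivation_monomial_deriv scalar_mult_def mult_single)
    ultimately show ?case using step.IH by (simp add: lookup_add lookup_single del: plus_fun_apply)
  qed
  ultimately have "Poly_Mapping.lookup (root_derivation S (\<rho> i) e ?\<chi>) (m + e) = 0" by blast
  then show False using m \<chi> by (simp add: root_derivation_monomial_deriv)
qed

end

section \<open>Lie algebras of root derivations without 2-cycles\<close>

locale root_algebra_no_two_cycle = root_datum M S \<rho> k
  for M S :: "('v \<Rightarrow> rat) set" and \<rho> :: "nat \<Rightarrow> 'v" and k :: nat +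
  fixes L :: "('v, 'k::field_char_0) alg_op set"
  assumes L: "lie_subalgebra S L" and no_two_cycle: "\<not> contains_two_cycle M S \<rho> k L"
begin

abbreviation R :: "nat \<Rightarrow> ('v \<Rightarrow> rat) set" where
  "R \<equiv> roots_of M S \<rho> k L"

text \<open>The arcs of \<open>root_graph\<close>, read on ray indices instead of
  subalgebras.\<close>

definition edge :: "nat \<Rightarrow> nat \<Rightarrow> bool" where
  "edge j i \<longleftrightarrow> (\<exists>e\<in>R i. e (\<rho> j) > 0)"

lemma R_demazure: "e \<in> R i \<Longrightarrow> e \<in> demazure_roots M \<rho> k i"
  by (simp add: roots_of_def)

text \<open>Here \<open>i \<noteq> j\<close> because \<open>e' (\<rho> j) = -1\<close>, so
  \<open>e (\<rho> j)\<close> is nonnegative, and a positive value would give a 2-cycle.\<close>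

lemma opposite_pairing_zero:
  assumes "i \<in> {1..k}" "j \<in> {1..k}" "e \<in> R i" "e' \<in> R j" "e' (\<rho> i) > 0"
  shows "e (\<rho> j) = 0"
proof -
  have "\<not> e (\<rho> j) > 0" using no_two_cycle assms unfolding contains_two_cycle_def by blast
  moreover have "i \<noteq> j" using assms demazure_root_diag[OF R_demazure, of e' j] by auto
  ultimately show ?thesis using demazure_root_nonneg[OF R_demazure, of e i j] assms by auto
qed

text \<open>One of the two terms of the bracket vanishes by \<open>opposite_pairing_zero\<close>;
  the other has a coefficient that is nonzero in characteristic zero, so it can be divided out
  inside \<open>L\<close>.\<close>

lemma R_add:
  assumes ij: "i \<in> {1..k}" "j \<in> {1..k}" and e: "e \<in> R i" "e' \<in> R j" and pos: "e' (\<rho> i) > 0"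
  shows "e + e' \<in> R j"
    and "lie_bracket (root_derivation S (\<rho> i) e) (root_derivation S (\<rho> j) e') =
      op_scale (of_rat (e' (\<rho> i))) (root_derivation S (\<rho> j) (e + e') :: ('v, 'k) alg_op)" (is "?B = _")
proof -
  have zero: "e (\<rho> j) = 0" using opposite_pairing_zero assms by blast
  then show B: "?B = op_scale (of_rat (e' (\<rho> i))) (root_derivation S (\<rho> j) (e + e'))"
    using lie_bracket_root_derivation[of i e j e'] ij e by (simp add: R_demazure)
  have "?B \<in> L" using L e by (auto simp: lie_subalgebra_def roots_of_def)
  then have "op_scale (inverse (of_rat (e' (\<rho> i)))) ?B \<in> L"
    using L by (auto simp: lie_subalgebra_def intro: op.subspace_scale)
  then have "root_derivation S (\<rho> j) (e + e') \<in> L" using pos unfolding B by simp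
  then show "e + e' \<in> R j"
    using demazure_root_add[OF ij R_demazure R_demazure] e zero pos by (simp add: roots_of_def)
qed

lemma edge_irrefl: "\<not> edge i i"
  by (auto simp: edge_def dest!: R_demazure demazure_root_diag)

lemma edge_trans:
  assumes ijl: "i \<in> {1..k}" "j \<in> {1..k}" "l \<in> {1..k}" and "edge i j" "edge j l"
  shows "edge i l"
proof -
  obtain e e' where e: "e \<in> R j" "e (\<rho> i) > 0" "e' \<in> R l" "e' (\<rho> j) > 0"
    using assms by (auto simp: edge_def)
  \<comment> \<open>If \<open>i = l\<close>, then \<open>e\<close> and \<open>e'\<close> would form
    a 2-cycle. Hence \<open>e'\<close> is nonnegative on \<open>\<rho> i\<close> and cannot cancel
    the positive value of \<open>e\<close>.\<close>
  have "i \<noteq> l" using opposite_pairing_zero[of j l e e'] ijl e by auto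
  then have "(e + e') (\<rho> i) > 0"
    using e ijl demazure_root_nonneg[OF R_demazure, of e' l i] by simp
  then show ?thesis using R_add(1)[of j l e e'] ijl e unfolding edge_def by blast
qed

text \<open>Either one root is positive on the ray of the other, and \<open>R_add\<close> applies,
  or the bracket vanishes. Allowing \<open>c = 0\<close> with any \<open>l\<close> gives both
  outcomes the same form.\<close>

lemma lie_bracket_cases:
  assumes ij: "i \<in> {1..k}" "j \<in> {1..k}" and e: "e \<in> R i" "e' \<in> R j"
  shows "\<exists>c l. l \<in> {1..k} \<and> (c = 0 \<or> e + e' \<in> R l) \<and>
    lie_bracket (root_derivation S (\<rho> i) e) (root_derivation S (\<rho> j) e') =
      op_scale c (root_derivation S (\<rho> l) (e + e') :: ('v, 'k) alg_op)"
proof -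
  consider "e' (\<rho> i) > 0" | "e (\<rho> j) > 0" | "i = j" | "e' (\<rho> i) = 0" "e (\<rho> j) = 0"
    using demazure_root_nonneg[OF R_demazure] assms by (metis antisym_conv1)
  then show ?thesis
  proof cases
    case 1
    then show ?thesis using R_add[OF ij e] ij by blast
  next
    case 2
    have "lie_bracket (root_derivation S (\<rho> i) e) (root_derivation S (\<rho> j) e') =
      op_scale (- of_rat (e (\<rho> j))) (root_derivation S (\<rho> i) (e + e') :: ('v, 'k) alg_op)"
      using R_add(2)[OF ij(2,1) e(2,1) 2] by (subst lie_bracket_skew) (simp add: add.commute)
    moreover have "e + e' \<in> R i" using R_add(1)[OF ij(2,1) e(2,1) 2] by (simp add: add.commute)
    ultimately show ?thesis using ij by blast
  next
    case 3
    then have "lie_bracket (root_derivation S (\<rho> i) e) (root_derivation S (\<rho> j) e') =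
      op_scale 0 (root_derivation S (\<rho> i) (e + e') :: ('v, 'k) alg_op)"
      using lie_bracket_root_derivation[of i e j e'] ij e
      by (simp add: R_demazure demazure_root_diag)
    then show ?thesis using ij by blast
  next
    case 4
    then have "lie_bracket (root_derivation S (\<rho> i) e) (root_derivation S (\<rho> j) e') =
      op_scale 0 (root_derivation S (\<rho> i) (e + e') :: ('v, 'k) alg_op)"
      using lie_bracket_root_derivation[of i e j e'] ij e by (simp add: R_demazure)
    then show ?thesis using ij by blast
  qed
qed

text \<open>Since the root sets are nonempty, distinct indices give distinct vertices, so
  transitivity and irreflexivity pass from \<open>edge\<close> to the arcs. The arcs then equal
  their transitive closure, in which a cycle would produce a loop.\<close>

lemma acyclic_root_graph:
  assumes r: "r \<le> k" and ne: "\<And>i. i \<in> {1..r} \<Longrightarrow> R i \<noteq> {}"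
  shows "\<not> has_oriented_cycle (root_graph M S \<rho> k r L)"
proof
  let ?G = "root_graph M S \<rho> k r L" and ?V = "root_subalgebra M S \<rho> k L"
  have arcs: "parcs ?G = {(?V j, ?V i) | i j. i \<in> {1..r} \<and> j \<in> {1..r} \<and> edge j i}"
    by (simp add: root_graph_def edge_def)
  have inj: "i = j" if "?V i = ?V j" "i \<in> {1..r}" "j \<in> {1..r}" for i j
    using root_subalgebra_inj[of i j L] that r ne by auto
  have "trans (parcs ?G)"
    unfolding arcs
  proof (rule transI, clarify)
    fix i j i' j' assume *: "i \<in> {1..r}" "j \<in> {1..r}" "edge j i" "i' \<in> {1..r}" "j' \<in> {1..r}"
      "edge j' i'" "?V i = ?V j'"
    then have "edge j i'" using inj[of i j'] edge_trans[of j i i'] r by auto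
    with * show "\<exists>i'' j''. (?V j, ?V i') = (?V j'', ?V i'') \<and> i'' \<in> {1..r} \<and> j'' \<in> {1..r} \<and> edge j'' i''"
      by blast
  qed
  moreover have "(u, u) \<notin> parcs ?G" for u
  proof
    assume "(u, u) \<in> parcs ?G"
    then obtain i j where "i \<in> {1..r}" "j \<in> {1..r}" "edge j i" "?V j = ?V i"
      unfolding arcs by auto
    then show False using inj[of j i] edge_irrefl by simp
  qed
  ultimately have no: "(u, u) \<notin> (parcs ?G)\<^sup>+" for u
    by simp
  interpret wf_digraph "with_proj ?G"
    by unfold_locales (auto simp: root_graph_def)
  assume "has_oriented_cycle ?G"
  then obtain p u where "awalk u p u" "p \<noteq> []"
    unfolding has_oriented_cycle_def cycle_def by auto
  from reachable1_awalkI[OF this] no show False by simp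
qed

text \<open>For \<open>e\<close> in \<open>R i\<close> the ray \<open>\<rho> i\<close> contributes
  \<open>- w i\<close>, and positive contributions come only from \<open>l\<close> with
  \<open>edge l i\<close>. As the values of \<open>e\<close> on the rays are bounded on the finite
  set \<open>A\<close>, fast growing weights let \<open>- w i\<close> dominate.\<close>

lemma exists_root_weights:
  assumes A: "finite A"
  shows "\<exists>w. (\<forall>i. w i > (0::rat)) \<and>
    (\<forall>i\<in>{1..k}. \<forall>e\<in>A \<inter> R i. (\<Sum>l=1..k. w l * e (\<rho> l)) \<le> - 1)"
proof -
  define C where "C = (\<Sum>e\<in>A. \<Sum>l=1..k. \<bar>e (\<rho> l)\<bar>)"
  have C: "C \<ge> 0" unfolding C_def by (intro sum_nonneg) auto
  have bound: "e (\<rho> l) \<le> C" if "e \<in> A" "l \<in> {1..k}" for e l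
  proof -
    have "e (\<rho> l) \<le> (\<Sum>l=1..k. \<bar>e (\<rho> l)\<bar>)"
      using member_le_sum[of l "{1..k}" "\<lambda>l. \<bar>e (\<rho> l)\<bar>"] that by auto
    also have "\<dots> \<le> C"
      unfolding C_def
      using member_le_sum[of e A "\<lambda>e. \<Sum>l=1..k. \<bar>e (\<rho> l)\<bar>"] that A by (auto intro: sum_nonneg)
    finally show ?thesis .
  qed
  obtain w :: "nat \<Rightarrow> rat" where w: "\<And>i. w i > 0"
    "\<And>i. i \<in> {1..k} \<Longrightarrow> w i \<ge> 1 + (\<Sum>l | l \<in> {1..k} \<and> edge l i. C * w l)"
  proof -
    have "\<exists>w. (\<forall>i. w i > (0::rat)) \<and>
        (\<forall>i\<in>{1..k}. w i \<ge> 1 + (\<Sum>l | l \<in> {1..k} \<and> edge l i. C * w l))"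
      by (rule exists_decreasing_weights[OF _ C edge_irrefl]) (simp, rule edge_trans)
    then show ?thesis using that by blast
  qed
  have "(\<Sum>l=1..k. w l * e (\<rho> l)) \<le> - 1" if i: "i \<in> {1..k}" and e: "e \<in> A" "e \<in> R i" for i e
  proof -
    have term_le: "w l * e (\<rho> l) \<le> (if edge l i then C * w l else 0)"
      if l: "l \<in> {1..k}" "l \<noteq> i" for l
    proof (cases "edge l i")
      case True
      then show ?thesis using bound[of e l] e l w(1)[of l] by (simp add: mult.commute)
    next
      case False
      then show ?thesis using e w(1)[of l] by (auto simp: edge_def mult_le_0_iff not_less)
    qed
    have "(\<Sum>l=1..k. w l * e (\<rho> l)) = - w i + (\<Sum>l\<in>{1..k} - {i}. w l * e (\<rho> l))"
      using i demazure_root_diag[OF R_demazure[OF e(2)]] by (simp add: sum.remove)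
    also have "\<dots> \<le> - w i + (\<Sum>l\<in>{1..k} - {i}. if edge l i then C * w l else 0)"
      by (intro add_left_mono sum_mono term_le) auto
    also have "(\<Sum>l\<in>{1..k} - {i}. if edge l i then C * w l else 0) =
        (\<Sum>l | l \<in> {1..k} \<and> edge l i. C * w l)"
      using edge_irrefl by (intro sum.mono_neutral_cong) auto
    finally show ?thesis using w(2)[OF i] by simp
  qed
  then show ?thesis using w(1) by blast
qed

lemma finite_dim_nilpotent:
  assumes gens: "finite gens" "gens \<subseteq> root_derivations M S \<rho> k" and L_gen: "L = lie_generated S gens"
  shows "lie_finite_dim L \<and> lie_nilpotent L"
proof -
  define d :: "nat \<times> ('v \<Rightarrow> rat) \<Rightarrow> ('v, 'k) alg_op"
    where "d = (\<lambda>(i, e). root_derivation S (\<rho> i) e)"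
  have gens_L: "gens \<subseteq> L" unfolding L_gen lie_generated_def by (rule hull_subset)
  \<comment> \<open>Each generator is given an index consisting of a ray and a root, because the
    weight \<open>\<Phi>\<close> is a function of the root and not of the operator.\<close>
  have "\<forall>D\<in>gens. \<exists>t. d t = D \<and> fst t \<in> {1..k} \<and> snd t \<in> R (fst t)"
    using gens(2) gens_L by (fastforce simp: d_def root_derivations_def roots_of_def)
  then obtain h where h: "\<And>D. D \<in> gens \<Longrightarrow> d (h D) = D \<and> fst (h D) \<in> {1..k} \<and> snd (h D) \<in> R (fst (h D))"
    by metis
  define A where "A = snd ` h ` gens"
  have A: "finite A" using gens by (simp add: A_def)
  obtain w :: "nat \<Rightarrow> rat" where w: "\<And>i. w i > 0"
    and w_gen: "\<And>i e. i \<in> {1..k} \<Longrightarrow> e \<in> A \<Longrightarrow> e \<in> R i \<Longrightarrow> (\<Sum>l=1..k. w l * e (\<rho> l)) \<le> - 1"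
    using exists_root_weights[OF A] by blast
  define \<Phi> where "\<Phi> e = (\<Sum>l=1..k. w l * e (\<rho> l))" for e
  define W where "W = (\<Sum>i=1..k. w i)"
  have \<Phi>_add: "\<Phi> (e + e') = \<Phi> e + \<Phi> e'" for e e'
    by (simp add: \<Phi>_def distrib_left sum.distrib)
  have \<Phi>_gen: "\<Phi> e \<le> - 1" if "e \<in> A" for e
    using that h w_gen unfolding A_def \<Phi>_def by blast
  have \<Phi>_list: "\<Phi> (sum_list xs) \<le> - of_nat (length xs)" if "set xs \<subseteq> A" for xs
    using that
  proof (induction xs)
    case Nil
    show ?case by (simp add: \<Phi>_def)
  next
    case (Cons x xs)
    then show ?case using \<Phi>_gen[of x] by (simp add: \<Phi>_add del: plus_fun_apply)
  qed
  \<comment> \<open>A root of ray \<open>i\<close> is -1 on \<open>\<rho> i\<close> and nonnegative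
    on the other rays; \<open>W\<close> makes the bound uniform in \<open>i\<close>.\<close>
  have \<Phi>_ge: "- W \<le> \<Phi> e" if "i \<in> {1..k}" "e \<in> R i" for i e
  proof -
    have "- w l \<le> w l * e (\<rho> l)" if "l \<in> {1..k}" for l
      using demazure_root_diag[OF R_demazure, of e i] demazure_root_nonneg[OF R_demazure, of e i l]
        \<open>e \<in> R i\<close> that w[of l]
      by (cases "l = i") (auto intro: order_trans[OF _ mult_nonneg_nonneg])
    then have "(\<Sum>l=1..k. - w l) \<le> \<Phi> e" unfolding \<Phi>_def by (intro sum_mono)
    then show ?thesis by (simp add: W_def sum_negf)
  qed
  \<comment> \<open>Brackets add degrees, so \<open>T\<close> has to index the roots of
    \<open>L\<close> that are sums of degrees of generators.\<close>
  define T where "T = {(i, e). i \<in> {1..k} \<and> e \<in> R i \<and> (\<exists>xs. xs \<noteq> [] \<and> set xs \<subseteq> A \<and> sum_list xs = e)}"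
  \<comment> \<open>The shift by one makes \<open>T' 0\<close> all of \<open>T\<close>, to match the
    zeroth term of the lower central series.\<close>
  define T' where "T' n = {t \<in> T. \<Phi> (snd t) \<le> - of_nat (Suc n)}" for n
  have T'_0: "T' 0 = T"
  proof -
    have "\<Phi> e \<le> - 1" if T: "(i, e) \<in> T" for i e
    proof -
      obtain xs where xs: "xs \<noteq> []" "set xs \<subseteq> A" "sum_list xs = e"
        using T unfolding T_def by blast
      have "rat_of_nat (length xs) \<ge> of_nat 1"
        using xs(1) by (intro of_nat_mono) (simp add: Suc_le_eq)
      then show ?thesis using \<Phi>_list[OF xs(2)] unfolding xs(3) by linarith
    qed
    then show ?thesis by (auto simp: T'_def)
  qed
  \<comment> \<open>If a list of length \<open>n\<close> sums to a root of \<open>L\<close>, then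
    \<open>- W \<le> \<Phi> \<le> - n\<close> on the sum, so \<open>n \<le> W\<close>; there are
    finitely many such lists over \<open>A\<close>.\<close>
  have "finite T"
  proof (rule finite_subset)
    let ?X = "{xs. set xs \<subseteq> A \<and> length xs \<le> nat \<lceil>W\<rceil>}"
    show "T \<subseteq> {1..k} \<times> sum_list ` ?X"
    proof (clarsimp simp: T_def)
      fix i xs assume "Suc 0 \<le> i" "i \<le> k" "sum_list xs \<in> R i" "set xs \<subseteq> A"
      then have "of_nat (length xs) \<le> W"
        using \<Phi>_list[of xs] \<Phi>_ge[of i "sum_list xs"] by simp
      then have "length xs \<le> nat \<lceil>W\<rceil>" by linarith
      then show "sum_list xs \<in> sum_list ` ?X" using \<open>set xs \<subseteq> A\<close> by auto
    qed
    show "finite ({1..k} \<times> sum_list ` ?X)" using finite_lists_length_le[OF A] by simp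
  qed
  have dT: "d ` T \<subseteq> derivations S"
    by (auto simp: T_def d_def intro!: root_derivation_in_derivations dest: R_demazure)
  have T'_sub: "T' n \<subseteq> T" for n by (auto simp: T'_def)
  \<comment> \<open>The left factor comes from \<open>T = T' 0\<close>, so it lowers
    \<open>\<Phi>\<close> by at least 1.\<close>
  have bracket: "lie_bracket D E \<in> op.span (d ` T' (Suc n))"
    if D: "D \<in> op.span (d ` T)" and E: "E \<in> op.span (d ` T' n)" for D E n
  proof (rule lie_bracket_span[OF S_add dT _ op.subspace_span _ D E])
    show "d ` T' n \<subseteq> derivations S" using dT T'_sub by blast
    fix D E assume "D \<in> d ` T" "E \<in> d ` T' n"
    then obtain i e j e' where D: "(i, e) \<in> T' 0" "D = d (i, e)" and E: "(j, e') \<in> T' n" "E = d (j, e')"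
      unfolding T'_0 by force
    then have T: "(i, e) \<in> T" "(j, e') \<in> T" using T'_sub by auto
    then obtain c l where l: "l \<in> {1..k}" "c = 0 \<or> e + e' \<in> R l"
      and DE: "lie_bracket D E = op_scale c (d (l, e + e'))"
      using lie_bracket_cases[of i j e e'] by (auto simp: T_def D E d_def)
    \<comment> \<open>A nonzero bracket has its degree in \<open>R l\<close>, and concatenating the
      lists of both factors exhibits that degree as a sum over \<open>A\<close>.\<close>
    have "(l, e + e') \<in> T' (Suc n)" if "c \<noteq> 0"
    proof -
      obtain xs ys where "xs \<noteq> []" "set (xs @ ys) \<subseteq> A" "sum_list (xs @ ys) = e + e'"
        using T by (auto simp: T_def)
      then have "(l, e + e') \<in> T"
        using that l unfolding T_def by blast
      then show ?thesis using D(1) E(1) by (simp add: T'_def \<Phi>_add)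
    qed
    then show "lie_bracket D E \<in> op.span (d ` T' (Suc n))"
      unfolding DE by (cases "c = 0") (auto intro: op.span_zero op.span_scale op.span_base)
  qed
  have "lie_subalgebra S (op.span (d ` T))"
    unfolding lie_subalgebra_def
  proof (intro conjI ballI op.subspace_span)
    show "op.span (d ` T) \<subseteq> derivations S"
      using dT lie_subalgebra_derivations[OF S_add, where 'k = 'k]
      by (intro op.span_minimal) (simp_all add: lie_subalgebra_def)
    fix D E assume "D \<in> op.span (d ` T)" "E \<in> op.span (d ` T)"
    then show "lie_bracket D E \<in> op.span (d ` T)"
      using bracket[of D E 0] op.span_mono[OF image_mono[OF T'_sub], of d "Suc 0"]
      by (auto simp: T'_0)
  qed
  moreover have "gens \<subseteq> op.span (d ` T)"
  proof
    fix D assume D: "D \<in> gens"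
    have "\<exists>xs. xs \<noteq> [] \<and> set xs \<subseteq> A \<and> sum_list xs = snd (h D)"
      using D by (intro exI[of _ "[snd (h D)]"]) (simp add: A_def)
    then have "h D \<in> T" using h[OF D] by (simp add: T_def case_prod_beta)
    then show "D \<in> op.span (d ` T)" using h[OF D] by (metis imageI op.span_base)
  qed
  ultimately have "L \<subseteq> op.span (d ` T)"
    unfolding L_gen lie_generated_def by (intro hull_minimal)
  moreover have "op.span (d ` T) \<subseteq> L"
    using L by (intro op.span_minimal) (auto simp: lie_subalgebra_def T_def d_def roots_of_def)
  ultimately have L_span: "L = op.span (d ` T)" by blast
  have lcs: "lower_central_series L n \<subseteq> op.span (d ` T' n)" for n
  proof (induction n)
    case 0
    show ?case by (simp add: L_span T'_0)
  next
    case (Suc n)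
    show ?case
      unfolding lower_central_series.simps
    proof (rule op.span_minimal[OF _ op.subspace_span])
      show "{lie_bracket D E | D E. D \<in> L \<and> E \<in> lower_central_series L n} \<subseteq> op.span (d ` T' (Suc n))"
        using Suc.IH bracket[of _ _ n] L_span by blast
    qed
  qed
  \<comment> \<open>An element would have \<open>\<Phi>\<close> below the lower bound
    \<open>- W\<close>.\<close>
  have "T' (nat \<lceil>W\<rceil>) = {}"
  proof -
    have "\<not> \<Phi> e \<le> - of_nat (Suc (nat \<lceil>W\<rceil>))" if "i \<in> {1..k}" "e \<in> R i" for i e
      using \<Phi>_ge[OF that] by simp linarith
    then show ?thesis by (auto simp: T'_def T_def)
  qed
  \<comment> \<open>At a successor index the lower central series is a span by definition, so it
    contains 0 and the inclusion into the zero space is an equality.\<close>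
  then have "T' (Suc (nat \<lceil>W\<rceil>)) = {}"
    by (force simp: T'_def)
  then have "lower_central_series L (Suc (nat \<lceil>W\<rceil>)) = {0}"
    using lcs[of "Suc (nat \<lceil>W\<rceil>)"] op.span_zero by auto
  then show ?thesis
    using \<open>finite T\<close> unfolding lie_finite_dim_def lie_nilpotent_def L_span by blast
qed

end

section \<open>Rational polyhedral cones\<close>

text \<open>The usual conic hull when \<open>G\<close> is finite; for infinite \<open>G\<close> the
  sums are 0 by convention.\<close>

definition conic_hull :: "(rat \<Rightarrow> 'v::ab_group_add \<Rightarrow> 'v) \<Rightarrow> 'v set \<Rightarrow> 'v set" where
  "conic_hull scale G = {v. \<exists>c. (\<forall>g\<in>G. 0 \<le> c g) \<and> v = (\<Sum>g\<in>G. scale (c g) g)}"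

text \<open>Serves to scale vectors into the lattice and linear forms into the dual lattice.\<close>

lemma common_denominator:
  fixes f :: "'a \<Rightarrow> rat"
  assumes "finite A"
  shows "\<exists>d::nat. d > 0 \<and> (\<forall>a\<in>A. of_nat d * f a \<in> \<int>)"
  using assms
proof (induction A)
  case empty
  show ?case by (intro exI[of _ 1]) simp
next
  case (insert x A)
  then obtain d :: nat where d: "d > 0" "\<And>a. a \<in> A \<Longrightarrow> of_nat d * f a \<in> \<int>" by blast
  obtain p q :: int where pq: "q > 0" "f x = of_int p / of_int q"
    by (metis quotient_of_denom_pos quotient_of_div surj_pair)
  have "of_nat (d * nat q) * f a \<in> \<int>" if a: "a \<in> insert x A" for a
  proof (cases "a = x")
    case True
    have "of_nat (d * nat q) * f a = of_int (int d * p)" using pq True by simp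
    then show ?thesis by (metis Ints_of_int)
  next
    case False
    have "of_nat (d * nat q) * f a = of_int q * (of_nat d * f a)" using pq by simp
    then show ?thesis using d a False by (metis Ints_mult Ints_of_int insertE)
  qed
  then show ?case using d pq by (intro exI[of _ "d * nat q"]) auto
qed

locale rational_space = finite_dimensional_vector_space scale Basis
  for scale :: "rat \<Rightarrow> 'v::ab_group_add \<Rightarrow> 'v" and Basis
begin

abbreviation linear_form :: "('v \<Rightarrow> rat) \<Rightarrow> bool" where
  "linear_form f \<equiv> Vector_Spaces.linear scale (*) f"

definition lattice :: "'v set" where
  "lattice = {v. \<exists>z :: 'v \<Rightarrow> int. v = (\<Sum>b\<in>Basis. scale (of_int (z b)) b)}"

lemma linear_form_iff:
  "linear_form f \<longleftrightarrow> (\<forall>x y. f (x + y) = f x + f y) \<and> (\<forall>c x. f (scale c x) = c * f x)"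
proof -
  have "vector_space ((*) :: rat \<Rightarrow> rat \<Rightarrow> rat)" by unfold_locales (simp_all add: algebra_simps)
  then show ?thesis by (simp add: Vector_Spaces.linear_iff vector_space_axioms)
qed

lemma
  assumes "linear_form f"
  shows form_scale: "f (scale c x) = c * f x" and form_minus: "f (- x) = - f x"
    and form_diff: "f (x - y) = f x - f y" and form_sum: "f (sum g A) = (\<Sum>a\<in>A. f (g a))"
proof -
  interpret Vector_Spaces.linear scale "(*)" f by fact
  show "f (scale c x) = c * f x" "f (- x) = - f x" "f (x - y) = f x - f y"
    "f (sum g A) = (\<Sum>a\<in>A. f (g a))"
    by (simp_all add: scale neg diff sum)
qed

lemma linear_form_coordinate: "linear_form (\<lambda>v. representation Basis v b)"
  using linear_representation independent_Basis span_Basis by blast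

lemma vector_eq_coordinates: "(\<Sum>b\<in>Basis. scale (representation Basis v b) b) = v"
  by (rule sum_representation_eq) (simp_all add: independent_Basis span_Basis finite_Basis)

lemma linear_forms_separate:
  assumes "\<And>f. linear_form f \<Longrightarrow> f v = 0"
  shows "v = 0"
  using vector_eq_coordinates[of v] assms[OF linear_form_coordinate] by simp

text \<open>Farkas' lemma, by Bartl's induction: if some \<open>h\<close> is nonnegative on all \<open>a i\<close> but one, \<open>a m\<close>,
  and \<open>h b < 0\<close>, then all vectors are projected along \<open>a m\<close> to the kernel of \<open>h\<close>.\<close>

lemma farkas:
  assumes "finite I"
    and "\<And>f. linear_form f \<Longrightarrow> (\<And>i. i \<in> I \<Longrightarrow> 0 \<le> f (a i)) \<Longrightarrow> 0 \<le> f b"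
  shows "\<exists>u. (\<forall>i\<in>I. 0 \<le> u i) \<and> b = (\<Sum>i\<in>I. scale (u i) (a i))"
  using assms
proof (induction I arbitrary: a b)
  case empty
  have "f b = 0" if "linear_form f" for f
  proof -
    have "linear_form (\<lambda>x. - f x)" using that by (simp add: linear_form_iff)
    then show ?thesis using empty.prems[of f] empty.prems[of "\<lambda>x. - f x"] that by simp
  qed
  then show ?case using linear_forms_separate by simp
next
  case (insert m I)
  show ?case
  proof (cases "\<forall>f. linear_form f \<longrightarrow> (\<forall>i\<in>I. 0 \<le> f (a i)) \<longrightarrow> 0 \<le> f b")
    case True
    then obtain u where u: "\<forall>i\<in>I. 0 \<le> u i" "b = (\<Sum>i\<in>I. scale (u i) (a i))"
      using insert.IH[of a b] by blast
    have "b = (\<Sum>i\<in>insert m I. scale ((u(m := 0)) i) (a i))"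
      using insert.hyps u by (simp, intro sum.cong) auto
    then show ?thesis using u by (intro exI[of _ "u(m := 0)"]) auto
  next
    case False
    then obtain h where h: "linear_form h" "\<And>i. i \<in> I \<Longrightarrow> 0 \<le> h (a i)" "h b < 0"
      by (auto simp: not_le)
    have hm: "h (a m) < 0"
      using insert.prems[OF h(1)] h by (metis insertE not_le)
    define p where "p x = x - scale (h x / h (a m)) (a m)" for x
    have "\<exists>u. (\<forall>i\<in>I. 0 \<le> u i) \<and> p b = (\<Sum>i\<in>I. scale (u i) (p (a i)))"
    proof (rule insert.IH)
      fix f assume f: "linear_form f" and nonneg: "\<And>i. i \<in> I \<Longrightarrow> 0 \<le> f (p (a i))"
      \<comment> \<open>This is \<open>f\<close> composed with \<open>p\<close>. It vanishes at
        \<open>a m\<close>, so it satisfies the hypothesis for all of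
        \<open>insert m I\<close>.\<close>
      define f' where "f' x = f x - f (a m) / h (a m) * h x" for x
      have f': "linear_form f'"
        using f h(1) unfolding linear_form_iff f'_def by (simp add: algebra_simps add_divide_distrib)
      have f'_p: "f' x = f (p x)" for x
        by (simp add: f'_def p_def form_diff[OF f] form_scale[OF f])
      have "0 \<le> f' b"
      proof (rule insert.prems[OF f'])
        fix i assume "i \<in> insert m I"
        then show "0 \<le> f' (a i)" using nonneg hm by (auto simp: f'_p[symmetric]) (simp add: f'_def)
      qed
      then show "0 \<le> f (p b)" by (simp add: f'_p)
    qed
    then obtain u where u: "\<And>i. i \<in> I \<Longrightarrow> 0 \<le> u i" "p b = (\<Sum>i\<in>I. scale (u i) (p (a i)))"
      by blast
    \<comment> \<open>The total coefficient of \<open>a m\<close> after undoing the projection. It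
      is nonnegative because \<open>h\<close> is negative at \<open>b\<close> and \<open>a m\<close>
      and nonnegative at the other \<open>a i\<close>.\<close>
    define c where "c = h b / h (a m) - (\<Sum>i\<in>I. u i * (h (a i) / h (a m)))"
    have "(\<Sum>i\<in>I. u i * (h (a i) / h (a m))) \<le> 0"
      using u(1) h(2) hm by (intro sum_nonpos mult_nonneg_nonpos) (auto intro: divide_nonneg_neg)
    moreover have "h b / h (a m) \<ge> 0" using h(3) hm by (simp add: divide_nonpos_neg)
    ultimately have c: "0 \<le> c" by (simp add: c_def)
    have "b = p b + scale (h b / h (a m)) (a m)" by (simp add: p_def)
    also have "p b = (\<Sum>i\<in>I. scale (u i) (a i)) - scale (\<Sum>i\<in>I. u i * (h (a i) / h (a m))) (a m)"
      unfolding u(2) by (simp add: p_def scale_right_diff_distrib sum_subtractf scale_sum_left)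
    also have "(\<Sum>i\<in>I. scale (u i) (a i)) - scale (\<Sum>i\<in>I. u i * (h (a i) / h (a m))) (a m)
        + scale (h b / h (a m)) (a m) = (\<Sum>i\<in>I. scale (u i) (a i)) + scale c (a m)"
      unfolding c_def scale_left_diff_distrib by simp
    also have "\<dots> = (\<Sum>i\<in>insert m I. scale ((u(m := c)) i) (a i))"
    proof -
      have "(\<Sum>i\<in>I. scale (u i) (a i)) = (\<Sum>i\<in>I. scale ((u(m := c)) i) (a i))"
        using insert.hyps by (intro sum.cong) auto
      then show ?thesis using insert.hyps by (simp add: add.commute)
    qed
    finally show ?thesis using u(1) c by (intro exI[of _ "u(m := c)"]) auto
  qed
qed

section \<open>Conic hulls, minimal generators and extremal rays\<close>

lemma conic_hull_0: "0 \<in> conic_hull scale G"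
  unfolding conic_hull_def by (auto intro!: exI[of _ "\<lambda>_. 0"])

lemma conic_hull_add:
  assumes "x \<in> conic_hull scale G" "y \<in> conic_hull scale G"
  shows "x + y \<in> conic_hull scale G"
proof -
  obtain c d where "\<forall>g\<in>G. 0 \<le> c g" "x = (\<Sum>g\<in>G. scale (c g) g)"
    "\<forall>g\<in>G. 0 \<le> d g" "y = (\<Sum>g\<in>G. scale (d g) g)"
    using assms by (auto simp: conic_hull_def)
  then show ?thesis unfolding conic_hull_def
    by (auto intro!: exI[of _ "\<lambda>g. c g + d g"] simp: scale_left_distrib sum.distrib)
qed

lemma conic_hull_scale:
  assumes "x \<in> conic_hull scale G" "0 \<le> a"
  shows "scale a x \<in> conic_hull scale G"
proof -
  obtain c where "\<forall>g\<in>G. 0 \<le> c g" "x = (\<Sum>g\<in>G. scale (c g) g)"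
    using assms by (auto simp: conic_hull_def)
  then show ?thesis unfolding conic_hull_def using assms
    by (auto intro!: exI[of _ "\<lambda>g. a * c g"] simp: scale_sum_right)
qed

lemma conic_hull_sum:
  "(\<And>i. i \<in> I \<Longrightarrow> f i \<in> conic_hull scale G) \<Longrightarrow> sum f I \<in> conic_hull scale G"
  by (induction I rule: infinite_finite_induct) (auto intro: conic_hull_0 conic_hull_add)

lemma conic_hull_inc:
  assumes "finite G" "g \<in> G"
  shows "g \<in> conic_hull scale G"
proof -
  have "(\<Sum>x\<in>G. scale (if x = g then 1 else 0) x) = (\<Sum>x\<in>{g}. scale (if x = g then 1 else 0) x)"
    using assms by (intro sum.mono_neutral_right) auto
  then show ?thesis unfolding conic_hull_def
    by (auto intro!: exI[of _ "\<lambda>x. if x = g then 1 else 0"])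
qed

lemma conic_hull_minimal:
  assumes "G \<subseteq> conic_hull scale H"
  shows "conic_hull scale G \<subseteq> conic_hull scale H"
proof
  fix x assume "x \<in> conic_hull scale G"
  then obtain c where "\<forall>g\<in>G. 0 \<le> c g" and x: "x = (\<Sum>g\<in>G. scale (c g) g)"
    by (auto simp: conic_hull_def)
  then show "x \<in> conic_hull scale H"
    using assms unfolding x by (intro conic_hull_sum conic_hull_scale) auto
qed

text \<open>Take a generating set of least cardinality; a generator in the hull of the others could
  be dropped.\<close>

lemma minimal_conic_generators:
  assumes "polyhedral_cone scale \<Delta>"
  obtains G where "finite G" "\<Delta> = conic_hull scale G" "\<And>g. g \<in> G \<Longrightarrow> g \<notin> conic_hull scale (G - {g})"
proof -
  let ?P = "\<lambda>G. finite G \<and> \<Delta> = conic_hull scale G"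
  obtain G\<^sub>0 where "?P G\<^sub>0" using assms unfolding polyhedral_cone_def conic_hull_def by auto
  from ex_has_least_nat[of ?P, OF this, of card]
  obtain G where G: "?P G" and min: "\<And>H. ?P H \<Longrightarrow> card G \<le> card H"
    by (elim exE conjE) simp
  have "g \<notin> conic_hull scale (G - {g})" if g: "g \<in> G" for g
  proof
    assume "g \<in> conic_hull scale (G - {g})"
    then have "conic_hull scale G \<subseteq> conic_hull scale (G - {g})"
      using G by (intro conic_hull_minimal) (auto intro: conic_hull_inc)
    moreover have "conic_hull scale (G - {g}) \<subseteq> conic_hull scale G"
      using G by (intro conic_hull_minimal) (auto intro: conic_hull_inc)
    ultimately have "card G \<le> card (G - {g})" using G by (intro min) blast
    then show False using card_Diff1_less[of G g] G g by simp
  qed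
  then show ?thesis using that G by blast
qed

text \<open>The negative of one summand is the sum of the others, so it lies in the cone as
  well.\<close>

lemma pointed_sum_eq_0:
  assumes pointed: "pointed_cone (conic_hull scale G)" and "finite I"
    and f: "\<And>i. i \<in> I \<Longrightarrow> f i \<in> conic_hull scale G" and sum: "sum f I = 0" and i: "i \<in> I"
  shows "f i = 0"
proof -
  have "- f i = sum f (I - {i})"
    using sum i \<open>finite I\<close> by (simp add: sum.remove minus_unique)
  also have "\<dots> \<in> conic_hull scale G" using f by (intro conic_hull_sum) auto
  finally show ?thesis using pointed f[OF i] by (simp add: pointed_cone_def)
qed

text \<open>Expand \<open>x\<close> and \<open>y\<close> in the generators and compare their sum
  with \<open>scale c g\<close>: minimality controls the coefficient of \<open>g\<close>, and
  pointedness makes all other coefficients vanish.\<close>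

lemma minimal_generator_extremal:
  assumes G: "finite G" and \<Delta>: "\<Delta> = conic_hull scale G" and pointed: "pointed_cone \<Delta>"
    and min: "\<And>g. g \<in> G \<Longrightarrow> g \<notin> conic_hull scale (G - {g})" and g: "g \<in> G"
  shows "extremal_ray scale \<Delta> (ray scale g)"
proof -
  have nz: "h \<noteq> 0" if "h \<in> G" for h using min[OF that] conic_hull_0 by metis
  have extremal: "x \<in> ray scale g" if x: "x \<in> \<Delta>" and y: "y \<in> \<Delta>" and xy: "x + y \<in> ray scale g" for x y
  proof -
    obtain a where a: "\<forall>h\<in>G. 0 \<le> a h" "x = (\<Sum>h\<in>G. scale (a h) h)"
      using x \<Delta> by (auto simp: conic_hull_def)
    obtain b where b: "\<forall>h\<in>G. 0 \<le> b h" "y = (\<Sum>h\<in>G. scale (b h) h)"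
      using y \<Delta> by (auto simp: conic_hull_def)
    obtain c where c: "x + y = scale c g" using xy by (auto simp: ray_def)
    let ?rest = "\<Sum>h\<in>G - {g}. scale (a h + b h) h"
    have "x + y = (\<Sum>h\<in>G. scale (a h + b h) h)"
      by (simp add: a(2) b(2) scale_left_distrib sum.distrib)
    also have "\<dots> = scale (a g + b g) g + ?rest" using G g by (rule sum.remove)
    finally have eq: "scale (a g + b g - c) g + ?rest = 0"
      using c by (simp add: algebra_simps)
    have rest: "?rest \<in> conic_hull scale (G - {g})"
      using a b G by (intro conic_hull_sum conic_hull_scale conic_hull_inc) auto
    \<comment> \<open>Otherwise \<open>g\<close> would be a positive multiple of
      \<open>?rest\<close>, hence in the hull of the other generators.\<close>
    have "a g + b g - c \<ge> 0"
    proof (rule ccontr)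
      assume "\<not> a g + b g - c \<ge> 0"
      then have pos: "c - (a g + b g) > 0" by simp
      have "?rest = scale (c - (a g + b g)) g"
        using eq by (simp add: algebra_simps eq_neg_iff_add_eq_0)
      then have "g = scale (inverse (c - (a g + b g))) ?rest" using pos by simp
      then show False
        using conic_hull_scale[OF rest, of "inverse (c - (a g + b g))"] min[OF g] pos by simp
    qed
    \<comment> \<open>The coefficients of \<open>x + y - scale c g = 0\<close>, now all nonnegative,
      so that \<open>pointed_sum_eq_0\<close> applies.\<close>
    define t where "t h = (if h = g then a g + b g - c else a h + b h)" for h
    have t: "0 \<le> t h" if "h \<in> G" for h
      using that a b \<open>a g + b g - c \<ge> 0\<close> by (simp add: t_def)
    have "(\<Sum>h\<in>G. scale (t h) h) = 0"
      using eq sum.remove[OF G g, of "\<lambda>h. scale (t h) h"] by (simp add: t_def)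
    then have t_0: "scale (t h) h = 0" if "h \<in> G" for h
      using pointed_sum_eq_0[OF pointed[unfolded \<Delta>] G, of "\<lambda>h. scale (t h) h" h] t that G
      by (simp add: conic_hull_scale conic_hull_inc)
    have "a h + b h = 0" if "h \<in> G - {g}" for h
      using t_0[of h] that nz[of h] by (simp add: t_def)
    then have "a h = 0" if "h \<in> G - {g}" for h
      using that a(1) b(1) by (metis Diff_iff add_nonneg_eq_0_iff)
    then have "x = scale (a g) g"
      using sum.remove[OF G g, of "\<lambda>h. scale (a h) h"] a(2) by simp
    then show ?thesis using a(1) g by (auto simp: ray_def)
  qed
  have "ray scale g \<subseteq> \<Delta>"
    using conic_hull_scale[OF conic_hull_inc[OF G g]] by (auto simp: ray_def \<Delta>)
  then show ?thesis
    unfolding extremal_ray_def using nz[OF g] extremal by (metis add.commute)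
qed

section \<open>Primitive lattice vectors and the dual monoid\<close>

lemma lattice_iff_coordinates: "v \<in> lattice \<longleftrightarrow> (\<forall>b\<in>Basis. representation Basis v b \<in> \<int>)"
proof
  assume "v \<in> lattice"
  then obtain z :: "'v \<Rightarrow> int" where v: "v = (\<Sum>b\<in>Basis. scale (of_int (z b)) b)"
    by (auto simp: lattice_def)
  show "\<forall>b\<in>Basis. representation Basis v b \<in> \<int>"
  proof
    fix b assume b: "b \<in> Basis"
    have "representation Basis v b = (\<Sum>b'\<in>Basis. of_int (z b') * representation Basis b' b)"
      by (simp add: v form_sum[OF linear_form_coordinate] form_scale[OF linear_form_coordinate])
    also have "\<dots> = (\<Sum>b'\<in>Basis. if b' = b then of_int (z b') else 0)"
      by (intro sum.cong refl) (simp add: representation_basis[OF independent_Basis])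
    finally show "representation Basis v b \<in> \<int>"
      using b finite_Basis by simp
  qed
next
  assume *: "\<forall>b\<in>Basis. representation Basis v b \<in> \<int>"
  have "v = (\<Sum>b\<in>Basis. scale (rat_of_int \<lfloor>representation Basis v b\<rfloor>) b)"
    using * vector_eq_coordinates[of v] by (simp add: of_int_floor cong: sum.cong)
  then show "v \<in> lattice"
    unfolding lattice_def by (auto intro!: exI[of _ "\<lambda>b. \<lfloor>representation Basis v b\<rfloor>"])
qed

text \<open>Among the lattice vectors that are positive multiples of \<open>v\<close>, one of least
  coordinate norm \<open>\<mu>\<close> is primitive. Such vectors exist by clearing
  denominators.\<close>

lemma exists_primitive_vector:
  assumes v: "v \<noteq> 0"
  shows "\<exists>u c. primitive_vector scale lattice u \<and> 0 < c \<and> v = scale c u"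
proof -
  define \<mu> where "\<mu> u = (\<Sum>b\<in>Basis. \<bar>representation Basis u b\<bar>)" for u
  have \<mu>_int: "\<mu> u \<in> \<int>" if "u \<in> lattice" for u
    using that unfolding \<mu>_def lattice_iff_coordinates by (intro Ints_sum Ints_abs) auto
  have \<mu>_scale: "\<mu> (scale c u) = \<bar>c\<bar> * \<mu> u" for c u
    by (simp add: \<mu>_def form_scale[OF linear_form_coordinate] abs_mult sum_distrib_left)
  have \<mu>_nonneg: "\<mu> u \<ge> 0" for u unfolding \<mu>_def by (intro sum_nonneg) auto
  have \<mu>_pos: "\<mu> u > 0" if "u \<noteq> 0" for u
  proof (rule ccontr)
    assume "\<not> \<mu> u > 0"
    then have "\<mu> u = 0" using \<mu>_nonneg[of u] by simp
    then have "\<forall>b\<in>Basis. representation Basis u b = 0"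
      using finite_Basis by (simp add: \<mu>_def sum_nonneg_eq_0_iff)
    then show False using vector_eq_coordinates[of u] that by simp
  qed
  let ?P = "\<lambda>u. u \<in> lattice \<and> (\<exists>c>0. v = scale c u)"
  obtain d :: nat where d: "d > 0" "\<And>b. b \<in> Basis \<Longrightarrow> of_nat d * representation Basis v b \<in> \<int>"
    using common_denominator[OF finite_Basis] by blast
  have "?P (scale (of_nat d) v)"
    using d by (auto simp: lattice_iff_coordinates form_scale[OF linear_form_coordinate]
        intro!: exI[of _ "inverse (of_nat d)"])
  then obtain u where u: "?P u" and min: "\<And>w. ?P w \<Longrightarrow> nat \<lfloor>\<mu> u\<rfloor> \<le> nat \<lfloor>\<mu> w\<rfloor>"
    using ex_has_least_nat[of ?P _ "\<lambda>w. nat \<lfloor>\<mu> w\<rfloor>"] by blast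
  \<comment> \<open>On the lattice \<open>\<mu>\<close> takes nonnegative integer values, so
    rounding down loses nothing.\<close>
  have min': "\<mu> u \<le> \<mu> w" if "?P w" for w
    using min[OF that] \<mu>_int[of u] \<mu>_int[of w] \<mu>_nonneg[of u] \<mu>_nonneg[of w] u that
    by (auto elim!: Ints_cases)
  obtain c where c: "0 < c" "v = scale c u" using u by blast
  have "n = 1" if w: "w \<in> lattice" and uw: "u = scale (of_nat n) w" for w and n :: nat
  proof -
    have nz: "n \<noteq> 0" "w \<noteq> 0" using v c uw by auto
    then have "\<exists>c>0. v = scale c w"
      using c uw by (intro exI[of _ "c * of_nat n"]) simp
    \<comment> \<open>The left side is \<open>\<mu> u\<close>, and \<open>w\<close> competes with
      \<open>u\<close> for the minimum.\<close>
    then have "of_nat n * \<mu> w \<le> 1 * \<mu> w" using min'[of w] w \<mu>_scale[of "of_nat n" w] uw by simp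
    then have "rat_of_nat n \<le> 1" using \<mu>_pos[OF nz(2)] by (simp only: mult_le_cancel_right_pos)
    then show ?thesis using nz by simp
  qed
  moreover have "u \<noteq> 0" using c(2) v by auto
  ultimately have "primitive_vector scale lattice u"
    using u unfolding primitive_vector_def by blast
  then show ?thesis using c by (intro exI conjI)
qed

text \<open>The cone is generated by a minimal set, whose elements span extremal rays and are
  positive multiples of ray generators.\<close>

lemma dual_cone_nonneg_on_rays:
  assumes cone: "polyhedral_cone scale \<Delta>" "pointed_cone \<Delta>" and f: "linear_form f"
    and nonneg: "\<And>v. v \<in> ray_generators scale lattice \<Delta> \<Longrightarrow> 0 \<le> f v" and v: "v \<in> \<Delta>"
  shows "0 \<le> f v"
proof -
  obtain G where G: "finite G" "\<Delta> = conic_hull scale G"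
    and min: "\<And>g. g \<in> G \<Longrightarrow> g \<notin> conic_hull scale (G - {g})"
    using minimal_conic_generators[OF cone(1)] by blast
  have "0 \<le> f g" if g: "g \<in> G" for g
  proof -
    have "g \<noteq> 0" using min[OF g] conic_hull_0 by metis
    then obtain u c where u: "primitive_vector scale lattice u" and c: "0 < c" "g = scale c u"
      using exists_primitive_vector by blast
    have "ray scale g = ray scale u"
    proof
      show "ray scale g \<subseteq> ray scale u" using c by (auto simp: ray_def)
      show "ray scale u \<subseteq> ray scale g"
      proof
        fix x assume "x \<in> ray scale u"
        then obtain a where "0 \<le> a" "x = scale a u" by (auto simp: ray_def)
        then show "x \<in> ray scale g"
          using c by (auto simp: ray_def intro!: exI[of _ "a / c"])
      qed
    qed
    then have "u \<in> ray_generators scale lattice \<Delta>"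
      using minimal_generator_extremal[OF G cone(2) min g] u by (simp add: ray_generators_def)
    then show ?thesis using nonneg c by (simp add: form_scale[OF f])
  qed
  moreover obtain a where "\<forall>g\<in>G. 0 \<le> a g" "v = (\<Sum>g\<in>G. scale (a g) g)"
    using v G by (auto simp: conic_hull_def)
  ultimately show ?thesis
    by (auto simp: form_sum[OF f] form_scale[OF f] intro!: sum_nonneg)
qed

text \<open>By pointedness \<open>- v\<close> lies outside the cone, so Farkas' lemma gives a
  separating form, which becomes integral after clearing denominators.\<close>

lemma exists_dual_monoid_pos:
  assumes cone: "polyhedral_cone scale \<Delta>" "pointed_cone \<Delta>" and v: "v \<in> \<Delta>" "v \<noteq> 0"
  shows "\<exists>m\<in>dual_monoid scale lattice \<Delta>. 0 < m v"
proof -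
  obtain G where G: "finite G" "\<Delta> = conic_hull scale G"
    using cone(1) by (auto simp: polyhedral_cone_def conic_hull_def)
  have "- v \<notin> \<Delta>" using v cone(2) by (auto simp: pointed_cone_def)
  then have "\<not> (\<exists>u. (\<forall>g\<in>G. 0 \<le> u g) \<and> - v = (\<Sum>g\<in>G. scale (u g) g))"
    unfolding G(2) conic_hull_def by blast
  then obtain f where f: "linear_form f" "\<And>g. g \<in> G \<Longrightarrow> 0 \<le> f g" "\<not> 0 \<le> f (- v)"
    using farkas[OF G(1), of "\<lambda>g. g" "- v"] by blast
  obtain d :: nat where d: "d > 0" "\<And>b. b \<in> Basis \<Longrightarrow> of_nat d * f b \<in> \<int>"
    using common_denominator[OF finite_Basis] by blast
  define m where "m x = of_nat d * f x" for x
  have m: "linear_form m" using f(1) by (simp add: linear_form_iff m_def algebra_simps)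
  have "m x \<in> \<int>" if "x \<in> lattice" for x
    using that d(2) by (auto simp: lattice_def form_sum[OF m] form_scale[OF m] m_def[symmetric]
        intro!: Ints_sum Ints_mult)
  moreover have "0 \<le> m x" if "x \<in> \<Delta>" for x
    using that f(2) unfolding G(2) conic_hull_def
    by (auto simp: form_sum[OF m] form_scale[OF m] intro!: sum_nonneg mult_nonneg_nonneg)
      (simp add: m_def)
  ultimately have "m \<in> dual_monoid scale lattice \<Delta>"
    using m by (simp add: dual_monoid_def dual_lattice_def)
  moreover have "0 < m v" using f d form_minus[OF f(1)] by (simp add: m_def)
  ultimately show ?thesis by blast
qed

lemma root_datum_ray_generators:
  assumes cone: "polyhedral_cone scale \<Delta>" "pointed_cone \<Delta>"
    and rays: "\<rho> ` {1..k} = ray_generators scale lattice \<Delta>"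
  shows "root_datum (dual_lattice scale lattice) (dual_monoid scale lattice \<Delta>) \<rho> k"
proof
  have \<rho>: "\<rho> i \<in> ray_generators scale lattice \<Delta>" if "i \<in> {1..k}" for i
    using that rays by blast
  have \<rho>_lattice: "\<rho> i \<in> lattice" "\<rho> i \<noteq> 0" if "i \<in> {1..k}" for i
    using \<rho>[OF that] by (simp_all add: ray_generators_def primitive_vector_def)
  have \<rho>_cone: "\<rho> i \<in> \<Delta>" if "i \<in> {1..k}" for i
  proof -
    have "\<rho> i = scale 1 (\<rho> i)" by simp
    then have "\<rho> i \<in> ray scale (\<rho> i)" unfolding ray_def by (metis (mono_tags) mem_Collect_eq zero_le_one)
    then show ?thesis using \<rho>[OF that] by (auto simp: ray_generators_def extremal_ray_def)
  qed
  show add: "e + e' \<in> dual_lattice scale lattice"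
    if "e \<in> dual_lattice scale lattice" "e' \<in> dual_lattice scale lattice" for e e'
    using that by (auto simp: dual_lattice_def linear_form_iff algebra_simps)
  show int: "e (\<rho> i) \<in> \<int>" if "e \<in> dual_lattice scale lattice" "i \<in> {1..k}" for e i
    using that \<rho>_lattice by (simp add: dual_lattice_def)
  show "m + m' \<in> dual_monoid scale lattice \<Delta>"
    if "m \<in> dual_monoid scale lattice \<Delta>" "m' \<in> dual_monoid scale lattice \<Delta>" for m m'
    using that add by (auto simp: dual_monoid_def)
  show "\<exists>m\<in>dual_monoid scale lattice \<Delta>. m (\<rho> i) \<noteq> 0" if "i \<in> {1..k}" for i
    using exists_dual_monoid_pos[OF cone \<rho>_cone[OF that] \<rho>_lattice(2)[OF that]]
    by (metis less_irrefl)
  show "m + e \<in> dual_monoid scale lattice \<Delta>"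
    if m: "m \<in> dual_monoid scale lattice \<Delta>" and i: "i \<in> {1..k}"
      and e: "e \<in> demazure_roots (dual_lattice scale lattice) \<rho> k i" and nz: "m (\<rho> i) \<noteq> 0" for m i e
  proof -
    have m_nonneg: "0 \<le> m (\<rho> j)" if "j \<in> {1..k}" for j
      using m \<rho>_cone that by (simp add: dual_monoid_def)
    have "m (\<rho> i) \<in> \<int>" using int[of m i] m i by (simp add: dual_monoid_def)
    \<comment> \<open>By integrality a nonzero value of \<open>m\<close> on \<open>\<rho> i\<close>
      is at least 1, which compensates for the value -1 of \<open>e\<close>.\<close>
    then have m_i: "1 \<le> m (\<rho> i)" using nz m_nonneg[OF i] by (auto elim!: Ints_cases)
    have "0 \<le> (m + e) (\<rho> j)" if "j \<in> {1..k}" for j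
    proof (cases "j = i")
      case True
      then show ?thesis using m_i e by (simp add: demazure_roots_def)
    next
      case False
      then have "0 \<le> e (\<rho> j)" using e that by (simp add: demazure_roots_def)
      then show ?thesis using m_nonneg[OF that] by simp
    qed
    then have "0 \<le> (m + e) u" if "u \<in> ray_generators scale lattice \<Delta>" for u
      using that unfolding rays[symmetric] by blast
    moreover have me: "m + e \<in> dual_lattice scale lattice"
      using m e by (intro add) (simp_all add: dual_monoid_def demazure_roots_def)
    ultimately show ?thesis
      using dual_cone_nonneg_on_rays[OF cone, of "m + e"] by (simp add: dual_monoid_def dual_lattice_def)
  qed
qed

end

section \<open>Acyclicity, finite dimension and nilpotency\<close>

theorem proposition4p7:
  fixes scale :: "rat \<Rightarrow> 'v::ab_group_add \<Rightarrow> 'v"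
    and N \<Delta> :: "'v set"
    and M S :: "('v \<Rightarrow> rat) set"
    and \<rho> :: "nat \<Rightarrow> 'v"
    and k r :: nat
    and gens L :: "('v, 'k::{alg_closed_field, field_char_0}) alg_op set"
  assumes lattice: "full_lattice scale N"
    and cone: "polyhedral_cone scale \<Delta>" "pointed_cone \<Delta>"
    and no_torus_factor: "full_dimensional scale \<Delta>"
    and M: "M = dual_lattice scale N"
    and S: "S = dual_monoid scale N \<Delta>"
    and rays: "bij_betw \<rho> {1..k} (ray_generators scale N \<Delta>)"
    and gens: "finite gens" "gens \<subseteq> root_derivations M S \<rho> k"
    and L: "L = lie_generated S gens"
    and numbering: "r \<le> k" "\<forall>i\<in>{1..k}. roots_of M S \<rho> k L i \<noteq> {} \<longleftrightarrow> i \<le> r"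
    and no_two_cycle: "\<not> contains_two_cycle M S \<rho> k L"
  shows "\<not> has_oriented_cycle (root_graph M S \<rho> k r L)
    \<and> lie_finite_dim L \<and> lie_nilpotent L"
proof -
  \<comment> \<open>A basis of the lattice is also a basis of the rational space; in terms of it
    \<open>N\<close> is \<open>lattice\<close>.\<close>
  obtain Basis where basis: "finite_dimensional_vector_space scale Basis"
    and N: "N = {v. \<exists>z :: 'v \<Rightarrow> int. v = (\<Sum>b\<in>Basis. scale (of_int (z b)) b)}"
    using lattice unfolding full_lattice_def by blast
  note L_generated = L
  from basis interpret rational_space scale Basis by (simp add: rational_space_def)
  interpret root_datum M S \<rho> k
    using root_datum_ray_generators[OF cone, of \<rho> k] rays N
    unfolding M S by (simp add: lattice_def bij_betw_def)
  interpret root_algebra_no_two_cycle M S \<rho> k L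
    by unfold_locales (use lie_generated_root_derivations[OF gens(2)] L no_two_cycle in auto)
  show ?thesis
    \<comment> \<open>The numbering makes the root sets of the vertices \<open>1, ..., r\<close>
      nonempty.\<close>
    using acyclic_root_graph[OF numbering(1)] numbering finite_dim_nilpotent[OF gens L_generated] by auto
qed

end
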